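(* Let $(S,\mathcal L)$ be a pre-Hilbert space logic such that $\dim S=\aleph_0$. The following are equivalent. (i) $\tau_o(\mathcal L)$ is a Hausdorff topology. (ii) $S$ is a Hilbert space (i.e. $S$ is complete). (iii) There exists an o-continuous state on $(S,\mathcal L)$, i.e. $(S,\mathcal L)_*\neq\emptyset$.
   Context: Let $S$ be a pre-Hilbert space (real or complex inner product space). For $A\subseteq S$ put $A^{\perp_S}:=\{x\in S:\langle x,a\rangle=0\ \forall a\in A\}$. A linear subspace $M$ of $S$ is orthogonally closed if $M=M^{\perp_S\perp_S}$. For $u\in S$, $[u]$ denotes the linear span of $u$. The orthogonal dimension $\dim S$ is the cardinality of any maximal orthonormal system of $S$ (a set of orthonormal vectors $A\subseteq S$ with $A^{\perp_S}=\{0\}$; all such sets have the same cardinality). A pre-Hilbert space logic is a pair $(S,\mathcal L)$ where $S$ is a pre-Hilbert space and $\mathcal L$ is a family of orthogonally closed linear subspaces of $S$ such that: $\{0\}\in\mathcal L$; if $M\in\mathcal L$ then $M^{\perp_S}\in\mathcal L$; if $M\in\mathcal L$ and $u\in S$ then $M+[u]\in\mathcal L$. $\mathcal L$ is regarded as a poset under inclusion, and $\vee,\wedge$ denote suprema and infima in this poset (when they exist). In a poset $(P,\le)$, $x_\gamma\uparrow x$ (resp. $x_\gamma\downarrow x$) means that the net $(x_\gamma)$ is increasing with supremum $x$ (resp. decreasing with infimum $x$). A net $(x_\gamma)$ in $P$ o-converges to $x\in P$ if there are nets $(a_\gamma),(b_\gamma)$ in $P$ (same index set) with $a_\gamma\le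 x_\gamma\le b_\gamma$ for every $\gamma$, $a_\gamma\uparrow x$ and $b_\gamma\downarrow x$. A subset $X\subseteq P$ is o-closed if no net in $X$ o-converges to a point outside $X$. The o-closed sets are the closed sets of the order topology $\tau_o(P)$. A function between posets is o-continuous if it maps every net o-converging to $x$ to a net o-converging to the image of $x$. A state on $(S,\mathcal L)$ is a function $s:\mathcal L\to[0,1]$ with $s(S)=1$ and $s(A_1\vee A_2)=s(A_1)+s(A_2)$ whenever $A_1,A_2,A_1\vee A_2\in\mathcal L$ and $A_1\perp A_2$. $(S,\mathcal L)_*$ denotes the set of o-continuous states on $(S,\mathcal L)$. *)

theory Defs
  imports "HOL-Analysis.Analysis" "HOL-Library.Lub_Glb"
begin

section \<open>The scalar fields \<open>\<real>\<close> and \<open>\<complex>\<close>\<close>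

text \<open>
  One class for the two scalar fields, so that real and complex inner product spaces are treated
  uniformly. The lemma \<open>rc_field_real_or_complex\<close> below shows that the axioms
  admit nothing else: the field is either \<open>\<real>\<close> with the trivial conjugation, or it is
  \<open>\<real> + \<real>i\<close> with \<open>i\<^sup>2 = -1\<close> and the usual conjugation.
\<close>

class rc_field = real_normed_field +
  fixes rc_cnj :: "'a \<Rightarrow> 'a"
  assumes rc_cnj_add: "rc_cnj (x + y) = rc_cnj x + rc_cnj y"
    and rc_cnj_mult: "rc_cnj (x * y) = rc_cnj x * rc_cnj y"
    and rc_cnj_scaleR_1: "rc_cnj (r *\<^sub>R 1) = r *\<^sub>R 1"
    and rc_mult_cnj_scaleR: "x * rc_cnj x = (norm x)\<^sup>2 *\<^sub>R 1"

lemma rc_cnj_of_real: "rc_cnj (of_real r) = (of_real r :: 'k::rc_field)"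
  by (simp only: of_real_def rc_cnj_scaleR_1)

lemma rc_mult_cnj: "x * rc_cnj x = (of_real ((norm x)\<^sup>2) :: 'k::rc_field)"
  by (simp only: of_real_def rc_mult_cnj_scaleR)

instantiation real :: rc_field
begin
definition rc_cnj_real :: "real \<Rightarrow> real" where "rc_cnj_real x = x"
instance by standard (auto simp: rc_cnj_real_def power2_eq_square)
end

instantiation complex :: rc_field
begin
definition rc_cnj_complex :: "complex \<Rightarrow> complex" where "rc_cnj_complex = cnj"
instance by standard (auto simp: rc_cnj_complex_def complex_norm_square scaleR_conv_of_real simp flip: of_real_power)
end

lemma rc_add_cnj_Reals:
  fixes x :: "'k::rc_field"
  shows "x + rc_cnj x \<in> \<real>"
proof -
  have c1: "rc_cnj 1 = (1::'k)" by (metis of_real_1 rc_cnj_of_real)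
  have "(1 + x) * rc_cnj (1 + x) = 1 + (x + rc_cnj x) + x * rc_cnj x"
    by (simp add: rc_cnj_add c1 algebra_simps)
  hence "x + rc_cnj x = of_real ((norm (1 + x))\<^sup>2) - 1 - of_real ((norm x)\<^sup>2)"
    unfolding rc_mult_cnj by (simp add: algebra_simps)
  thus ?thesis by (metis Reals_1 Reals_diff Reals_of_real)
qed

lemma rc_field_real_or_complex:
  "(\<forall>x::'k::rc_field. x \<in> \<real> \<and> rc_cnj x = x) \<or>
   (\<exists>i::'k. i * i = -1 \<and> rc_cnj i = - i \<and>
      (\<forall>x::'k. \<exists>!(a,b). x = of_real a + of_real b * i))"
proof (cases "\<forall>x::'k. x \<in> \<real>")
  case True
  thus ?thesis by (metis Reals_cases rc_cnj_of_real)
next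
  case False
  have decomp: "\<exists>a y. x = of_real a + y \<and> rc_cnj y = - y" for x :: 'k
  proof -
    obtain r where r: "x + rc_cnj x = of_real r" using rc_add_cnj_Reals[of x] by (auto elim: Reals_cases)
    define y where "y = x - of_real (r/2)"
    have x: "x = of_real (r/2) + y" by (simp add: y_def)
    have "rc_cnj x = of_real (r/2) + rc_cnj y"
      by (subst x) (simp only: rc_cnj_add rc_cnj_of_real)
    hence "of_real r = of_real (r/2) + of_real (r/2) + (y + rc_cnj y)" using r x by (simp add: algebra_simps)
    moreover have "(of_real (r/2) + of_real (r/2) :: 'k) = of_real r"
      by (metis field_sum_of_halves of_real_add)
    ultimately have "rc_cnj y = - y" by (simp add: add_eq_0_iff)
    thus ?thesis using x by blast
  qed
  have sq: "y * y = - of_real ((norm y)\<^sup>2)" if "rc_cnj y = - y" for y :: 'k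
    using rc_mult_cnj[of y] that by (metis minus_mult_right minus_minus)
  obtain x0 :: 'k where x0: "x0 \<notin> \<real>" using False by blast
  obtain a0 j where j: "x0 = of_real a0 + j" "rc_cnj j = - j" using decomp by blast
  have j0: "j \<noteq> 0" using x0 j by auto
  define i where "i = of_real (1 / norm j) * j"
  have ci: "rc_cnj i = - i" by (simp only: i_def rc_cnj_mult rc_cnj_of_real j) simp
  have ni: "norm i = 1" using j0 by (simp only: i_def norm_mult norm_of_real) simp
  have ii: "i * i = -1" using sq[OF ci] ni by simp
  have "i \<notin> \<real>"
  proof
    assume "i \<in> \<real>"
    then obtain r where "i = of_real r" by (auto elim: Reals_cases)
    hence "of_real (r * r) = (of_real (-1) :: 'k)" using ii by simp
    hence "r * r = -1" by (subst (asm) of_real_eq_iff)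
    thus False by (metis zero_le_square neg_0_le_iff_le not_one_le_zero)
  qed
  have ex: "\<exists>a b. x = of_real a + of_real b * i" for x :: 'k
  proof -
    obtain a y where y: "x = of_real a + y" "rc_cnj y = - y" using decomp by blast
    have "(y - of_real (norm y) * i) * (y + of_real (norm y) * i)
            = y * y - of_real ((norm y)\<^sup>2) * (i * i)"
      by (simp add: algebra_simps power2_eq_square)
    also have "\<dots> = 0" using sq[OF y(2)] ii by simp
    finally have "y - of_real (norm y) * i = 0 \<or> y + of_real (norm y) * i = 0"
      by (simp only: mult_eq_0_iff)
    hence "y = of_real (norm y) * i \<or> y = of_real (- norm y) * i"
      by (simp only: of_real_minus mult_minus_left right_minus_eq eq_neg_iff_add_eq_0)
    thus ?thesis using y(1) by metis
  qed
  have uniq: "a = a' \<and> b = b'"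
    if "of_real a + of_real b * i = of_real a' + of_real b' * i" for a b a' b'
  proof -
    have "of_real (b - b') * i - of_real (a' - a)
            = (of_real a + of_real b * i) - (of_real a' + of_real b' * i)"
      by (simp add: algebra_simps)
    hence eq: "of_real (b - b') * i = of_real (a' - a)" using that by simp
    have "b = b'"
    proof (rule ccontr)
      assume "b \<noteq> b'"
      hence nz: "of_real (b - b') \<noteq> (0::'k)" by (simp only: of_real_eq_0_iff right_minus_eq) simp
      have "i = (of_real (b - b') * i) / of_real (b - b')"
        by (simp only: nonzero_mult_div_cancel_left[OF nz])
      also have "\<dots> = of_real ((a' - a) / (b - b'))" by (simp only: eq of_real_divide)
      finally have "i = of_real ((a' - a) / (b - b'))" .
      thus False using \<open>i \<notin> \<real>\<close> by (metis Reals_of_real)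
    qed
    moreover from this have "of_real a' = (of_real a :: 'k)" using that by simp
    ultimately show ?thesis by simp
  qed
  have "\<exists>!(a,b). x = of_real a + of_real b * i" for x :: 'k
  proof -
    obtain a b where ab: "x = of_real a + of_real b * i" using ex by blast
    show ?thesis
      by (rule ex1I[of _ "(a, b)"]) (use ab uniq in auto)
  qed
  thus ?thesis using ii ci by blast
qed


section \<open>Order convergence and the order topology\<close>

text \<open>
  A poset is a subset \<open>P\<close> of a type of class \<open>order\<close> with the induced order; suprema and infima
  are taken inside \<open>P\<close> (\<open>isLub P\<close>, \<open>isGlb P\<close>).
\<close>

definition directed_index :: "'i set \<Rightarrow> ('i \<Rightarrow> 'i \<Rightarrow> bool) \<Rightarrow> bool" where
  "directed_index I le \<longleftrightarrow> I \<noteq> {} \<and> reflp_on I le \<and> transp_on I le \<and>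
     (\<forall>i\<in>I. \<forall>j\<in>I. \<exists>k\<in>I. le i k \<and> le j k)"

definition net_up ::
  "'a::order set \<Rightarrow> 'i set \<Rightarrow> ('i \<Rightarrow> 'i \<Rightarrow> bool) \<Rightarrow> ('i \<Rightarrow> 'a) \<Rightarrow> 'a \<Rightarrow> bool" where
  "net_up P I le a l \<longleftrightarrow> a ` I \<subseteq> P \<and> (\<forall>i\<in>I. \<forall>j\<in>I. le i j \<longrightarrow> a i \<le> a j) \<and> isLub P (a ` I) l"

definition net_down ::
  "'a::order set \<Rightarrow> 'i set \<Rightarrow> ('i \<Rightarrow> 'i \<Rightarrow> bool) \<Rightarrow> ('i \<Rightarrow> 'a) \<Rightarrow> 'a \<Rightarrow> bool" where
  "net_down P I le b l \<longleftrightarrow> b ` I \<subseteq> P \<and> (\<forall>i\<in>I. \<forall>j\<in>I. le i j \<longrightarrow> b j \<le> b i) \<and> isGlb P (b ` I) l"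

definition o_converges ::
  "'a::order set \<Rightarrow> 'i set \<Rightarrow> ('i \<Rightarrow> 'i \<Rightarrow> bool) \<Rightarrow> ('i \<Rightarrow> 'a) \<Rightarrow> 'a \<Rightarrow> bool" where
  "o_converges P I le x l \<longleftrightarrow> directed_index I le \<and> x ` I \<subseteq> P \<and>
     (\<exists>a b. net_up P I le a l \<and> net_down P I le b l \<and> (\<forall>i\<in>I. a i \<le> x i \<and> x i \<le> b i))"

text \<open>
  HOL cannot quantify over the type of the index set inside a formula. The next two definitions
  therefore range over all directed sets in the type \<open>'a \<times> 'a \<times> 'a\<close>. The lemmas
  \<open>o_closed_any_net\<close> and \<open>o_continuous_any_net\<close> show that nets over arbitrary index types are
  thereby covered: an index \<open>i\<close> can be replaced by the triple \<open>(a i, x i, b i)\<close>.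
\<close>

definition o_closed :: "'a::order set \<Rightarrow> 'a set \<Rightarrow> bool" where
  "o_closed P X \<longleftrightarrow> X \<subseteq> P \<and>
     (\<forall>(I :: ('a \<times> 'a \<times> 'a) set) le x l. x ` I \<subseteq> X \<longrightarrow> o_converges P I le x l \<longrightarrow> l \<in> X)"

definition o_continuous :: "'a::order set \<Rightarrow> 'b::order set \<Rightarrow> ('a \<Rightarrow> 'b) \<Rightarrow> bool" where
  "o_continuous P Q f \<longleftrightarrow> f ` P \<subseteq> Q \<and>
     (\<forall>(I :: ('a \<times> 'a \<times> 'a) set) le x l.
        o_converges P I le x l \<longrightarrow> o_converges Q I le (f \<circ> x) (f l))"

definition o_topology :: "'a::order set \<Rightarrow> 'a topology" where
  "o_topology P = topology (\<lambda>U. U \<subseteq> P \<and> o_closed P (P - U))"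

lemma o_converges_triple_net:
  fixes I :: "'i set" and x :: "'i \<Rightarrow> 'a::order"
  assumes "o_converges P I le x l"
  obtains J :: "('a \<times> 'a \<times> 'a) set" and le' y t where
    "o_converges P J le' y l" "t ` I = J" "\<forall>i. y (t i) = x i"
    "\<forall>i\<in>I. \<forall>j\<in>I. le i j \<longrightarrow> le' (t i) (t j)"
proof -
  from assms obtain a b where d: "directed_index I le" and xP: "x ` I \<subseteq> P"
    and a: "net_up P I le a l" and b: "net_down P I le b l"
    and ab: "\<forall>i\<in>I. a i \<le> x i \<and> x i \<le> b i"
    unfolding o_converges_def by blast
  define t where "t = (\<lambda>i. (a i, x i, b i))"
  define le' :: "'a \<times> 'a \<times> 'a \<Rightarrow> 'a \<times> 'a \<times> 'a \<Rightarrow> bool"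
    where "le' = (\<lambda>p q. fst p \<le> fst q \<and> snd (snd q) \<le> snd (snd p))"
  have mono: "le' (t i) (t j)" if "i \<in> I" "j \<in> I" "le i j" for i j
    using a b that unfolding net_up_def net_down_def le'_def t_def by auto
  have d': "directed_index (t ` I) le'"
    unfolding directed_index_def
  proof (intro conjI)
    show "t ` I \<noteq> {}" using d by (auto simp: directed_index_def)
    show "reflp_on (t ` I) le'" by (auto simp: reflp_on_def le'_def)
    show "transp_on (t ` I) le'" unfolding transp_on_def le'_def by (meson order_trans)
    show "\<forall>i\<in>t ` I. \<forall>j\<in>t ` I. \<exists>k\<in>t ` I. le' i k \<and> le' j k"
      using d mono unfolding directed_index_def by (simp add: ball_simps bex_simps) meson
  qed
  have im: "fst ` t ` I = a ` I" "(\<lambda>p. fst (snd p)) ` t ` I = x ` I" "(\<lambda>p. snd (snd p)) ` t ` I = b ` I"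
    by (auto simp: t_def image_image)
  have "o_converges P (t ` I) le' (\<lambda>p. fst (snd p)) l"
    unfolding o_converges_def
  proof (intro conjI exI)
    show "directed_index (t ` I) le'" by (rule d')
    show "(\<lambda>p. fst (snd p)) ` t ` I \<subseteq> P" using im xP by simp
    show "net_up P (t ` I) le' fst l" using a unfolding net_up_def im by (auto simp: le'_def)
    show "net_down P (t ` I) le' (\<lambda>p. snd (snd p)) l"
      using b unfolding net_down_def im by (auto simp: le'_def)
    show "\<forall>i\<in>t ` I. fst i \<le> fst (snd i) \<and> fst (snd i) \<le> snd (snd i)"
      using ab by (auto simp: t_def)
  qed
  thus thesis by (rule that[of _ le' _ t]) (use mono in \<open>auto simp: t_def\<close>)
qed

lemma o_closed_any_net:
  fixes I :: "'i set" and P :: "'a::order set"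
  assumes "o_closed P X" "x ` I \<subseteq> X" "o_converges P I le x l"
  shows "l \<in> X"
proof -
  from assms(3) obtain J :: "('a \<times> 'a \<times> 'a) set" and le' y t where
    J: "o_converges P J le' y l" "t ` I = J" "\<forall>i. y (t i) = x i"
       "\<forall>i\<in>I. \<forall>j\<in>I. le i j \<longrightarrow> le' (t i) (t j)"
    by (rule o_converges_triple_net) (rule that, assumption+)
  have "y ` J \<subseteq> X" using J assms(2) by auto
  thus ?thesis using assms(1) J(1) unfolding o_closed_def by blast
qed

lemma o_continuous_any_net:
  fixes I :: "'i set" and P :: "'a::order set"
  assumes "o_continuous P Q f" "o_converges P I le x l"
  shows "o_converges Q I le (f \<circ> x) (f l)"
proof -
  from assms(2) obtain J :: "('a \<times> 'a \<times> 'a) set" and le' y t where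
    J: "o_converges P J le' y l" "t ` I = J" "\<forall>i. y (t i) = x i"
       "\<forall>i\<in>I. \<forall>j\<in>I. le i j \<longrightarrow> le' (t i) (t j)"
    by (rule o_converges_triple_net) (rule that, assumption+)
  have "o_converges Q J le' (f \<circ> y) (f l)" using assms(1) J(1) unfolding o_continuous_def by blast
  then obtain a b where a: "net_up Q J le' a (f l)" and b: "net_down Q J le' b (f l)"
    and ab: "\<forall>i\<in>J. a i \<le> f (y i) \<and> f (y i) \<le> b i"
    unfolding o_converges_def by auto
  have im: "(a \<circ> t) ` I = a ` J" "(b \<circ> t) ` I = b ` J" using J(2) by (auto simp: image_comp[symmetric])
  have "directed_index I le" "x ` I \<subseteq> P" using assms(2) unfolding o_converges_def by auto
  moreover have "net_up Q I le (a \<circ> t) (f l)"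
    using a J(2,4) unfolding net_up_def im by auto
  moreover have "net_down Q I le (b \<circ> t) (f l)"
    using b J(2,4) unfolding net_down_def im by auto
  moreover have "\<forall>i\<in>I. (a \<circ> t) i \<le> (f \<circ> x) i \<and> (f \<circ> x) i \<le> (b \<circ> t) i"
    using ab J(2,3) by auto
  moreover have "(f \<circ> x) ` I \<subseteq> Q"
    using \<open>x ` I \<subseteq> P\<close> assms(1) unfolding o_continuous_def by auto
  ultimately show ?thesis unfolding o_converges_def by blast
qed

lemma o_converges_cofinal:
  assumes "o_converges P I le x l" "J \<subseteq> I" "\<And>i. i \<in> I \<Longrightarrow> \<exists>j\<in>J. le i j"
  shows "o_converges P J le x l"
proof -
  from assms(1) obtain a b where d: "directed_index I le" and xP: "x ` I \<subseteq> P"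
    and a: "net_up P I le a l" and b: "net_down P I le b l"
    and ab: "\<forall>i\<in>I. a i \<le> x i \<and> x i \<le> b i"
    unfolding o_converges_def by blast
  have d': "directed_index J le"
    unfolding directed_index_def
  proof (intro conjI ballI)
    show "J \<noteq> {}" using d assms(3) by (auto simp: directed_index_def)
    show "reflp_on J le" "transp_on J le"
      using d assms(2) by (auto simp: directed_index_def intro: reflp_on_subset transp_on_subset)
    fix i j assume ij: "i \<in> J" "j \<in> J"
    then obtain k where k: "k \<in> I" "le i k" "le j k" using d assms(2) unfolding directed_index_def by blast
    obtain m where m: "m \<in> J" "le k m" using assms(3) k by blast
    have "transp_on I le" using d by (simp add: directed_index_def)
    hence "le i m" "le j m" using k m ij assms(2) by (meson subsetD transp_onD)+
    thus "\<exists>k\<in>J. le i k \<and> le j k" using m by blast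
  qed
  have ua: "isUb P (a ` J) = isUb P (a ` I)"
  proof
    fix u
    have "a i \<le> u" if h: "\<forall>j\<in>J. a j \<le> u" "i \<in> I" for i
    proof -
      obtain j where "j \<in> J" "le i j" using assms(3) h(2) by blast
      hence "a i \<le> a j" using a assms(2) h(2) unfolding net_up_def by blast
      thus ?thesis using h(1) \<open>j \<in> J\<close> order_trans by blast
    qed
    thus "isUb P (a ` J) u = isUb P (a ` I) u"
      using assms(2) unfolding isUb_def setle_def by blast
  qed
  have lb: "isLb P (b ` J) = isLb P (b ` I)"
  proof
    fix u
    have "u \<le> b i" if h: "\<forall>j\<in>J. u \<le> b j" "i \<in> I" for i
    proof -
      obtain j where "j \<in> J" "le i j" using assms(3) h(2) by blast
      hence "b j \<le> b i" using b assms(2) h(2) unfolding net_down_def by blast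
      thus ?thesis using h(1) \<open>j \<in> J\<close> order_trans by blast
    qed
    thus "isLb P (b ` J) u = isLb P (b ` I) u"
      using assms(2) unfolding isLb_def setge_def by blast
  qed
  have "net_up P J le a l" using a assms(2) unfolding net_up_def isLub_def ua by blast
  moreover have "net_down P J le b l" using b assms(2) unfolding net_down_def isGlb_def lb by blast
  ultimately show ?thesis using d' xP ab assms(2) unfolding o_converges_def by blast
qed

lemma o_closed_Un:
  assumes X: "o_closed P X" and Y: "o_closed P Y"
  shows "o_closed P (X \<union> Y)"
  unfolding o_closed_def
proof (intro conjI allI impI)
  show "X \<union> Y \<subseteq> P" using X Y by (auto simp: o_closed_def)
  fix I :: "('a \<times> 'a \<times> 'a) set" and le x l
  assume xI: "x ` I \<subseteq> X \<union> Y" and c: "o_converges P I le x l"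
  show "l \<in> X \<union> Y"
  proof (cases "\<forall>i\<in>I. \<exists>j\<in>{j\<in>I. x j \<in> X}. le i j")
    case True
    have "o_converges P {j\<in>I. x j \<in> X} le x l" by (rule o_converges_cofinal[OF c]) (use True in auto)
    thus ?thesis using o_closed_any_net[OF X, of x "{j\<in>I. x j \<in> X}"] by blast
  next
    case False
    then obtain i0 where i0: "i0 \<in> I" "\<And>j. j \<in> I \<Longrightarrow> le i0 j \<Longrightarrow> x j \<notin> X" by blast
    have "\<exists>j\<in>{j\<in>I. x j \<in> Y}. le i j" if h: "i \<in> I" for i
    proof -
      obtain k where "k \<in> I" "le i k" "le i0 k"
        using c h i0(1) unfolding o_converges_def directed_index_def by blast
      thus ?thesis using i0(2) xI by blast
    qed
    hence "o_converges P {j\<in>I. x j \<in> Y} le x l" by (intro o_converges_cofinal[OF c]) auto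
    thus ?thesis using o_closed_any_net[OF Y, of x "{j\<in>I. x j \<in> Y}"] by blast
  qed
qed

lemma o_closed_Inter:
  assumes "\<C> \<noteq> {}" "\<And>X. X \<in> \<C> \<Longrightarrow> o_closed P X"
  shows "o_closed P (\<Inter>\<C>)"
  unfolding o_closed_def
proof (intro conjI allI impI)
  show "\<Inter>\<C> \<subseteq> P" using assms by (auto simp: o_closed_def)
  fix I :: "('a \<times> 'a \<times> 'a) set" and le x l
  assume "x ` I \<subseteq> \<Inter>\<C>" and c: "o_converges P I le x l"
  thus "l \<in> \<Inter>\<C>" using assms(2) o_closed_any_net[OF _ _ c] by blast
qed

lemma o_closed_whole: "o_closed P P"
  unfolding o_closed_def o_converges_def net_up_def by (blast dest: isLubD1a)

lemma o_closed_empty: "o_closed P {}"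
  by (auto simp: o_closed_def o_converges_def directed_index_def)

lemma istopology_o: "istopology (\<lambda>U. U \<subseteq> P \<and> o_closed P (P - U))"
  unfolding istopology_def
proof (intro conjI allI impI)
  fix S T assume "S \<subseteq> P \<and> o_closed P (P - S)" "T \<subseteq> P \<and> o_closed P (P - T)"
  thus "S \<inter> T \<subseteq> P" "o_closed P (P - S \<inter> T)" by (auto simp: Diff_Int intro: o_closed_Un)
next
  fix \<K> assume K: "\<forall>K\<in>\<K>. K \<subseteq> P \<and> o_closed P (P - K)"
  thus "\<Union>\<K> \<subseteq> P" by blast
  show "o_closed P (P - \<Union>\<K>)"
  proof (cases "\<K> = {}")
    case True thus ?thesis by (simp add: o_closed_whole)
  next
    case False
    hence "P - \<Union>\<K> = \<Inter>((\<lambda>K. P - K) ` \<K>)" by blast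
    moreover have "o_closed P (\<Inter>((\<lambda>K. P - K) ` \<K>))"
      by (rule o_closed_Inter) (use False K in auto)
    ultimately show ?thesis by simp
  qed
qed

lemma openin_o_topology: "openin (o_topology P) U \<longleftrightarrow> U \<subseteq> P \<and> o_closed P (P - U)"
  unfolding o_topology_def by (simp add: topology_inverse'[OF istopology_o])

lemma topspace_o_topology [simp]: "topspace (o_topology P) = P"
  by (rule subset_antisym) (auto simp: topspace_def openin_o_topology o_closed_empty intro!: exI[of _ P])

lemma closedin_o_topology: "closedin (o_topology P) X \<longleftrightarrow> o_closed P X"
  by (metis Diff_subset closedin_def double_diff o_closed_def openin_o_topology order_refl topspace_o_topology)


section \<open>Pre-Hilbert spaces\<close>

text \<open>
  A pre-Hilbert space over \<open>'k\<close> (that is, over \<open>\<real>\<close> or \<open>\<complex>\<close>). The class \<open>real_inner\<close>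
  on the vectors provides the norm and metric, so that completeness is the library's
  \<open>complete UNIV\<close>. This is no restriction: \<open>ip\<close> determines both the norm (axiom \<open>ip_self\<close>)
  and the real inner product, which is its real part (lemma \<open>ip_real_part\<close>), and every real
  or complex inner product space carries these canonically.
\<close>

locale pre_hilbert = vector_space scale
  for scale :: "'k::rc_field \<Rightarrow> 's::real_inner \<Rightarrow> 's" +
  fixes ip :: "'s \<Rightarrow> 's \<Rightarrow> 'k"
  assumes scale_of_real: "scale (of_real r) x = r *\<^sub>R x"
    and ip_add_left: "ip (x + y) z = ip x z + ip y z"
    and ip_scale_left: "ip (scale c x) y = c * ip x y"
    and ip_commute: "ip y x = rc_cnj (ip x y)"
    and ip_self: "ip x x = of_real ((norm x)\<^sup>2)"
begin

lemma ip_real_part: "ip x y + rc_cnj (ip x y) = of_real (2 * (x \<bullet> y))"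
proof -
  have "ip (x + y) (x + y) = ip x x + ip y y + (ip x y + rc_cnj (ip x y))"
    by (metis (no_types, opaque_lifting) ip_add_left ip_commute rc_cnj_add add.commute add.left_commute)
  hence "ip x y + rc_cnj (ip x y) = of_real ((norm (x + y))\<^sup>2 - (norm x)\<^sup>2 - (norm y)\<^sup>2)"
    by (simp add: ip_self)
  also have "(norm (x + y))\<^sup>2 - (norm x)\<^sup>2 - (norm y)\<^sup>2 = 2 * (x \<bullet> y)"
    by (simp add: power2_norm_eq_inner inner_add_left inner_add_right inner_commute)
  finally show ?thesis .
qed

definition perp :: "'s set \<Rightarrow> 's set" where
  "perp A = {x. \<forall>a\<in>A. ip x a = 0}"

definition orth_closed :: "'s set \<Rightarrow> bool" where
  "orth_closed M \<longleftrightarrow> subspace M \<and> perp (perp M) = M"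

definition maximal_orthonormal :: "'s set \<Rightarrow> bool" where
  "maximal_orthonormal A \<longleftrightarrow>
     (\<forall>a\<in>A. ip a a = 1) \<and> (\<forall>a\<in>A. \<forall>b\<in>A. a \<noteq> b \<longrightarrow> ip a b = 0) \<and> perp A = {0}"

text \<open>
  The orthogonal dimension is a cardinal \<open>c\<close>; all maximal orthonormal systems have the same
  cardinality, so it suffices to exhibit one of cardinality \<open>c\<close>.
\<close>

definition has_orth_dim :: "'c rel \<Rightarrow> bool" where
  "has_orth_dim c \<longleftrightarrow> (\<exists>A. maximal_orthonormal A \<and> (card_of A, c) \<in> ordIso)"

end

lemma pre_hilbert_real: "pre_hilbert (scaleR :: real \<Rightarrow> 's \<Rightarrow> 's::real_inner) inner"
  by unfold_locales
    (auto simp: scaleR_add_right scaleR_add_left inner_left_distrib rc_cnj_real_def power2_norm_eq_inner intro: inner_commute)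

lemma pre_hilbert_complex: "pre_hilbert ((*) :: complex \<Rightarrow> complex \<Rightarrow> complex) (\<lambda>x y. x * cnj y)"
  by unfold_locales
    (auto simp: algebra_simps rc_cnj_complex_def scaleR_conv_of_real
      simp flip: complex_norm_square of_real_power)


section \<open>Pre-Hilbert space logics\<close>

locale pre_hilbert_logic = pre_hilbert scale ip
  for scale :: "'k::rc_field \<Rightarrow> 's::real_inner \<Rightarrow> 's" and ip :: "'s \<Rightarrow> 's \<Rightarrow> 'k" +
  fixes L :: "'s set set"
  assumes orth_closed: "M \<in> L \<Longrightarrow> orth_closed M"
    and zero_mem: "{0} \<in> L"
    and perp_mem: "M \<in> L \<Longrightarrow> perp M \<in> L"
    and add_span_mem: "M \<in> L \<Longrightarrow> {x + y | x y. x \<in> M \<and> y \<in> span {u}} \<in> L"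
begin

text \<open>
  \<open>isLub L {A, B} C\<close> says that \<open>C\<close> is the supremum of \<open>A\<close> and \<open>B\<close> in the poset \<open>L\<close>, which in
  general is not a lattice. Values of \<open>s\<close> outside \<open>L\<close> are irrelevant.
\<close>

definition state :: "('s set \<Rightarrow> real) \<Rightarrow> bool" where
  "state s \<longleftrightarrow> s ` L \<subseteq> {0..1} \<and> s UNIV = 1 \<and>
     (\<forall>A\<in>L. \<forall>B\<in>L. \<forall>C\<in>L. A \<subseteq> perp B \<longrightarrow> isLub L {A, B} C \<longrightarrow> s C = s A + s B)"

definition o_continuous_states :: "('s set \<Rightarrow> real) set" where
  "o_continuous_states = {s. state s \<and> o_continuous L {0..1} s}"

end

end

theory Submission
  imports Defs
begin

text \<open>
  If \<open>S\<close> is complete, the projection theorem makes every vector state \<open>M \<mapsto> \<parallel>P\<^sub>M e\<parallel>\<^sup>2\<close> o-continuous: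
  since \<open>\<L>\<close> is closed under removing a vector, a supremum in \<open>\<L>\<close> of an increasing net of closed
  subspaces is the closure of their union. These states separate the points of \<open>\<L>\<close>.

  If \<open>S\<close> is incomplete, every o-open set \<open>U\<close> around \<open>{0}\<close> contains an increasing sequence of
  finite-dimensional subspaces with supremum \<open>S\<close>, so \<open>U\<close> meets every o-open set around \<open>S\<close>; this
  excludes both the Hausdorff property and o-continuous states. To push a finite-dimensional
  \<open>M \<in> U\<close> towards a vector \<open>e\<close> with \<open>e \<bottom> M\<close>, choose a point \<open>p\<close> of the completion outside \<open>S\<close>, near
  \<open>e\<close> and orthogonal to \<open>M\<close>. Because \<open>p \<notin> S\<close>, the subspaces \<open>F\<^sup>\<bottom>\<close>, for finite \<open>F \<subseteq> S \<inter> M\<^sup>\<bottom> \<inter> p\<^sup>\<bottom>\<close>,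
  decrease to \<open>M\<close>, so some \<open>F\<^sup>\<bottom>\<close> lies in \<open>U\<close>. It contains vectors of \<open>S\<close> arbitrarily close to
  \<open>p\<close>, and it is the supremum of its finite-dimensional subspaces containing \<open>M\<close> and such a vector.
\<close>

section \<open>Order convergence\<close>

lemma net_upI:
  assumes "\<And>i. i \<in> I \<Longrightarrow> a i \<in> P" "\<And>i j. i \<in> I \<Longrightarrow> j \<in> I \<Longrightarrow> le i j \<Longrightarrow> a i \<le> a j"
    and "x \<in> P" "\<And>i. i \<in> I \<Longrightarrow> a i \<le> x"
    and "\<And>y. y \<in> P \<Longrightarrow> (\<And>i. i \<in> I \<Longrightarrow> a i \<le> y) \<Longrightarrow> x \<le> y"
  shows "net_up P I le a x"
  using assms unfolding net_up_def isLub_def leastP_def isUb_def setle_def setge_def by auto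

lemma net_downI:
  assumes "\<And>i. i \<in> I \<Longrightarrow> b i \<in> P" "\<And>i j. i \<in> I \<Longrightarrow> j \<in> I \<Longrightarrow> le i j \<Longrightarrow> b j \<le> b i"
    and "x \<in> P" "\<And>i. i \<in> I \<Longrightarrow> x \<le> b i"
    and "\<And>y. y \<in> P \<Longrightarrow> (\<And>i. i \<in> I \<Longrightarrow> y \<le> b i) \<Longrightarrow> y \<le> x"
  shows "net_down P I le b x"
  using assms unfolding net_down_def isGlb_def greatestP_def isLb_def setle_def setge_def by auto

lemma net_up_const: "I \<noteq> {} \<Longrightarrow> x \<in> P \<Longrightarrow> net_up P I le (\<lambda>_. x) x"
  by (rule net_upI) auto

lemma net_down_const: "I \<noteq> {} \<Longrightarrow> x \<in> P \<Longrightarrow> net_down P I le (\<lambda>_. x) x"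
  by (rule net_downI) auto

lemma net_upD:
  assumes "net_up P I le a x"
  shows "x \<in> P" "\<And>i. i \<in> I \<Longrightarrow> a i \<in> P" "\<And>i. i \<in> I \<Longrightarrow> a i \<le> x"
    "\<And>i j. i \<in> I \<Longrightarrow> j \<in> I \<Longrightarrow> le i j \<Longrightarrow> a i \<le> a j"
    "\<And>y. y \<in> P \<Longrightarrow> (\<And>i. i \<in> I \<Longrightarrow> a i \<le> y) \<Longrightarrow> x \<le> y"
  using assms unfolding net_up_def isLub_def leastP_def isUb_def setle_def setge_def by auto

lemma net_downD:
  assumes "net_down P I le b x"
  shows "x \<in> P" "\<And>i. i \<in> I \<Longrightarrow> b i \<in> P" "\<And>i. i \<in> I \<Longrightarrow> x \<le> b i"
    "\<And>i j. i \<in> I \<Longrightarrow> j \<in> I \<Longrightarrow> le i j \<Longrightarrow> b j \<le> b i"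
    "\<And>y. y \<in> P \<Longrightarrow> (\<And>i. i \<in> I \<Longrightarrow> y \<le> b i) \<Longrightarrow> y \<le> x"
  using assms unfolding net_down_def isGlb_def greatestP_def isLb_def setle_def setge_def by auto

text \<open>The net lies between itself and the constant net \<open>x\<close>, so it o-converges to
  \<open>x\<close>; were it to miss \<open>U\<close>, its limit would lie in the o-closed complement
  of \<open>U\<close>.\<close>

lemma o_open_meets_net_up:
  assumes U: "openin (o_topology P) U" "x \<in> U"
    and I: "directed_index I le" and a: "net_up P I le a x"
  shows "\<exists>i\<in>I. a i \<in> U"
proof (rule ccontr)
  assume "\<not> ?thesis"
  hence "a ` I \<subseteq> P - U" using net_upD(2)[OF a] by blast
  moreover have "net_down P I le (\<lambda>_. x) x"
    using I net_upD(1)[OF a] by (intro net_down_const) (auto simp: directed_index_def)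
  hence "o_converges P I le a x"
    unfolding o_converges_def using I a net_upD(2,3)[OF a] by blast
  ultimately have "x \<in> P - U" using U(1) o_closed_any_net unfolding openin_o_topology by blast
  thus False using U(2) by blast
qed

lemma o_open_meets_net_down:
  assumes U: "openin (o_topology P) U" "x \<in> U"
    and I: "directed_index I le" and b: "net_down P I le b x"
  shows "\<exists>i\<in>I. b i \<in> U"
proof (rule ccontr)
  assume "\<not> ?thesis"
  hence "b ` I \<subseteq> P - U" using net_downD(2)[OF b] by blast
  moreover have "net_up P I le (\<lambda>_. x) x"
    using I net_downD(1)[OF b] by (intro net_up_const) (auto simp: directed_index_def)
  hence "o_converges P I le b x"
    unfolding o_converges_def using I b net_downD(2,3)[OF b] by blast
  ultimately have "x \<in> P - U" using U(1) o_closed_any_net unfolding openin_o_topology by blast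
  thus False using U(2) by blast
qed

section \<open>Level sets of o-continuous functions into the unit interval\<close>

lemma openin_o_topology_sublevel:
  fixes s :: "'a::order \<Rightarrow> real"
  assumes s: "o_continuous P {0..1} s"
  shows "openin (o_topology P) {x \<in> P. s x < c}"
proof -
  have "o_closed P {x \<in> P. c \<le> s x}"
    unfolding o_closed_def
  proof (intro conjI allI impI)
    fix I :: "('a \<times> 'a \<times> 'a) set" and le x l
    assume x: "x ` I \<subseteq> {x \<in> P. c \<le> s x}" and conv: "o_converges P I le x l"
    have l: "l \<in> P" using o_closed_any_net[OF o_closed_whole _ conv] x by blast
    have "o_converges {0..1} I le (s \<circ> x) (s l)" using s conv unfolding o_continuous_def by blast
    then obtain b where I: "I \<noteq> {}" and b: "net_down {0..1} I le b (s l)"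
      and sb: "\<And>i. i \<in> I \<Longrightarrow> s (x i) \<le> b i"
      unfolding o_converges_def directed_index_def comp_def by blast
    \<comment> \<open>The infimum \<open>s l\<close> is tested only against members of
      \<open>{0..1}\<close>. Truncating \<open>c\<close> at 0 gives such a lower bound; any
      \<open>b i\<close> keeps it at most 1.\<close>
    have cb: "max 0 c \<le> b i" if "i \<in> I" for i
      using that x sb[OF that] net_downD(2)[OF b that] by auto
    obtain i where "i \<in> I" using I by blast
    hence "max 0 c \<in> {0..1}" using cb[of i] net_downD(2)[OF b, of i] by simp
    hence "max 0 c \<le> s l" using cb by (rule net_downD(5)[OF b])
    thus "l \<in> {x \<in> P. c \<le> s x}" using l by simp
  qed auto
  moreover have "P - {x \<in> P. s x < c} = {x \<in> P. c \<le> s x}" by auto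
  ultimately show ?thesis unfolding openin_o_topology by auto
qed

lemma openin_o_topology_superlevel:
  fixes s :: "'a::order \<Rightarrow> real"
  assumes s: "o_continuous P {0..1} s"
  shows "openin (o_topology P) {x \<in> P. c < s x}"
proof -
  have "o_closed P {x \<in> P. s x \<le> c}"
    unfolding o_closed_def
  proof (intro conjI allI impI)
    fix I :: "('a \<times> 'a \<times> 'a) set" and le x l
    assume x: "x ` I \<subseteq> {x \<in> P. s x \<le> c}" and conv: "o_converges P I le x l"
    have l: "l \<in> P" using o_closed_any_net[OF o_closed_whole _ conv] x by blast
    have "o_converges {0..1} I le (s \<circ> x) (s l)" using s conv unfolding o_continuous_def by blast
    then obtain a where I: "I \<noteq> {}" and a: "net_up {0..1} I le a (s l)"
      and sa: "\<And>i. i \<in> I \<Longrightarrow> a i \<le> s (x i)"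
      unfolding o_converges_def directed_index_def comp_def by blast
    have ac: "a i \<le> min 1 c" if "i \<in> I" for i
      using that x sa[OF that] net_upD(2)[OF a that] by auto
    obtain i where "i \<in> I" using I by blast
    hence "min 1 c \<in> {0..1}" using ac[of i] net_upD(2)[OF a, of i] by simp
    hence "s l \<le> min 1 c" using ac by (rule net_upD(5)[OF a])
    thus "l \<in> {x \<in> P. s x \<le> c}" using l by simp
  qed auto
  moreover have "P - {x \<in> P. c < s x} = {x \<in> P. s x \<le> c}" by auto
  ultimately show ?thesis unfolding openin_o_topology by auto
qed

section \<open>Conjugation and completeness of the scalar field\<close>

lemma norm_rc_cnj: "norm (rc_cnj x) = norm (x :: 'k::rc_field)"
proof (cases "x = 0")
  case True
  then show ?thesis
    using rc_cnj_of_real[of 0, where 'k='k] by simp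
next
  case False
  have "norm x * norm (rc_cnj x) = norm x * norm x"
    using arg_cong[OF rc_mult_cnj[of x], of norm] by (simp add: norm_mult power2_eq_square)
  then show ?thesis using False by simp
qed

lemma rc_cnj_0 [simp]: "rc_cnj (0 :: 'k::rc_field) = 0"
  using rc_cnj_of_real[of 0, where 'k='k] by simp

lemma rc_cnj_eq_0_iff [simp]: "rc_cnj (x :: 'k::rc_field) = 0 \<longleftrightarrow> x = 0"
  by (metis norm_rc_cnj norm_eq_zero)

lemma rc_cnj_cnj: "rc_cnj (rc_cnj x) = (x :: 'k::rc_field)"
proof (cases "x = 0")
  case False
  have "rc_cnj x * rc_cnj (rc_cnj x) = rc_cnj x * x"
    by (metis mult.commute norm_rc_cnj rc_mult_cnj)
  thus ?thesis using False by simp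
qed simp

lemma bounded_linear_rc_cnj: "bounded_linear (rc_cnj :: 'k::rc_field \<Rightarrow> 'k)"
proof (rule bounded_linear_intro)
  show "rc_cnj (r *\<^sub>R x) = r *\<^sub>R rc_cnj x" for r and x :: 'k
    by (simp only: scaleR_conv_of_real rc_cnj_mult rc_cnj_of_real)
  show "norm (rc_cnj x) \<le> norm x * 1" for x :: 'k
    by (simp add: norm_rc_cnj)
qed (rule rc_cnj_add)

lemma Cauchy_of_real_convergent:
  fixes X :: "nat \<Rightarrow> 'k::rc_field"
  assumes "Cauchy X" and X: "\<And>n. X n = of_real (r n)"
  shows "convergent X"
proof -
  have "dist (X m) (X n) = dist (r m) (r n)" for m n
    by (simp add: X dist_norm flip: of_real_diff)
  hence "Cauchy r" using \<open>Cauchy X\<close> by (simp add: Cauchy_def)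
  then obtain l where "r \<longlonglongrightarrow> l" by (meson Cauchy_convergent_iff convergent_def)
  hence "(\<lambda>n. of_real (r n) :: 'k) \<longlonglongrightarrow> of_real l" by (rule tendsto_of_real)
  thus ?thesis unfolding convergent_def X[abs_def] by blast
qed

text \<open>The class \<open>rc_field\<close> does not assume completeness. It follows from the
  classification of the field: the real and imaginary parts of a Cauchy sequence are real Cauchy
  sequences.\<close>

lemma rc_Cauchy_convergent:
  fixes X :: "nat \<Rightarrow> 'k::rc_field"
  assumes C: "Cauchy X"
  shows "convergent X"
  using rc_field_real_or_complex[where 'k='k]
proof
  assume "\<forall>x::'k. x \<in> \<real> \<and> rc_cnj x = x"
  hence "\<exists>r. X n = of_real r" for n by (metis Reals_cases)
  then obtain r where "\<And>n. X n = of_real (r n)" by metis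
  thus ?thesis using Cauchy_of_real_convergent[OF C] by blast
next
  assume "\<exists>i::'k. i * i = -1 \<and> rc_cnj i = - i \<and> (\<forall>x::'k. \<exists>!(a,b). x = of_real a + of_real b * i)"
  then obtain i :: 'k where i: "i * i = -1" "rc_cnj i = - i"
    and ex: "\<forall>x::'k. \<exists>!(a,b). x = of_real a + of_real b * i" by blast
  have "\<exists>a b. X n = of_real a + of_real b * i" for n
    using ex[rule_format, of "X n"] by auto
  then obtain a b where ab: "\<And>n. X n = of_real (a n) + of_real (b n) * i" by metis
  have cab: "rc_cnj (X n) = of_real (a n) - of_real (b n) * i" for n
    by (simp only: ab rc_cnj_add rc_cnj_mult rc_cnj_of_real i) simp
  have i0: "i \<noteq> 0" using i by auto
  \<comment> \<open>Through conjugation, both coordinates are bounded linear in \<open>X n\<close>,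
    hence Cauchy.\<close>
  have "Cauchy (\<lambda>n. (X n + rc_cnj (X n)) * (1 / 2))"
    by (rule bounded_linear.Cauchy[OF _ C])
      (intro bounded_linear_compose[OF bounded_linear_mult_left] bounded_linear_add
        bounded_linear_sub bounded_linear_ident bounded_linear_rc_cnj)
  moreover have "(X n + rc_cnj (X n)) * (1 / 2) = of_real (a n)" for n
    by (simp only: cab) (simp add: ab)
  ultimately have 1: "convergent (\<lambda>n. of_real (a n) :: 'k)"
    using Cauchy_of_real_convergent[of "\<lambda>n. of_real (a n)" a] by simp
  have "Cauchy (\<lambda>n. (X n - rc_cnj (X n)) * (1 / (2 * i)))"
    by (rule bounded_linear.Cauchy[OF _ C])
      (intro bounded_linear_compose[OF bounded_linear_mult_left] bounded_linear_add
        bounded_linear_sub bounded_linear_ident bounded_linear_rc_cnj)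
  moreover have "(X n - rc_cnj (X n)) * (1 / (2 * i)) = of_real (b n)" for n
    by (simp only: cab) (simp add: ab i0 field_simps)
  ultimately have 2: "convergent (\<lambda>n. of_real (b n) :: 'k)"
    using Cauchy_of_real_convergent[of "\<lambda>n. of_real (b n)" b] by simp
  have "convergent (\<lambda>n. of_real (a n) + of_real (b n) * i)"
    by (intro convergent_add convergent_mult 1 2 convergent_const)
  thus ?thesis by (simp only: ab[symmetric])
qed

section \<open>Orthogonality in pre-Hilbert spaces\<close>

context pre_hilbert
begin

lemma ip_add_right: "ip x (y + z) = ip x y + ip x z"
  by (metis ip_add_left ip_commute rc_cnj_add)

lemma ip_scale_right: "ip x (scale c y) = rc_cnj c * ip x y"
  by (metis ip_commute ip_scale_left rc_cnj_mult)

lemma ip_eq_0_commute: "ip x y = 0 \<longleftrightarrow> ip y x = 0"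
  by (metis ip_commute rc_cnj_eq_0_iff)

lemma ip_self_eq_0_iff: "ip x x = 0 \<longleftrightarrow> x = 0"
  by (simp add: ip_self)

lemma norm_scale: "norm (scale c x) = norm c * norm x"
proof -
  have "(of_real ((norm (scale c x))\<^sup>2) :: 'k) = c * rc_cnj c * ip x x"
    by (simp only: ip_scale_left ip_scale_right mult_ac flip: ip_self)
  also have "\<dots> = of_real ((norm c * norm x)\<^sup>2)"
    by (simp add: rc_mult_cnj ip_self power_mult_distrib)
  finally show ?thesis by (simp only: of_real_eq_iff power2_eq_iff_nonneg norm_ge_zero mult_nonneg_nonneg)
qed

text \<open>Cauchy-Schwarz is known for the real inner product. Multiplying \<open>y\<close> by
  \<open>ip x y\<close> makes the value real, and there \<open>ip\<close> agrees with the real inner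
  product.\<close>

lemma norm_ip_le: "norm (ip x y) \<le> norm x * norm y"
proof -
  define c where "c = ip x y"
  have eq: "ip x (scale c y) = of_real ((norm c)\<^sup>2)"
    by (simp add: ip_scale_right c_def mult.commute rc_mult_cnj del: of_real_power)
  have "of_real ((norm c)\<^sup>2 + (norm c)\<^sup>2) = (of_real (2 * (x \<bullet> scale c y)) :: 'k)"
    using ip_real_part[of x "scale c y"] unfolding eq rc_cnj_of_real by simp
  hence "(norm c)\<^sup>2 = x \<bullet> scale c y"
    by (subst (asm) of_real_eq_iff) simp
  also have "\<dots> \<le> norm x * (norm c * norm y)"
    using norm_cauchy_schwarz[of x "scale c y"] by (simp add: norm_scale)
  finally have "norm c * norm c \<le> norm c * (norm x * norm y)"
    by (simp add: power2_eq_square mult_ac)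
  thus ?thesis unfolding c_def[symmetric]
    by (cases "norm c = 0") (simp_all add: mult_le_cancel_left)
qed

lemma bounded_bilinear_ip: "bounded_bilinear ip"
proof
  show "ip (r *\<^sub>R x) y = r *\<^sub>R ip x y" for r x y
    by (simp add: ip_scale_left scaleR_conv_of_real flip: scale_of_real)
  show "ip x (r *\<^sub>R y) = r *\<^sub>R ip x y" for r x y
    by (simp add: ip_scale_right rc_cnj_of_real scaleR_conv_of_real flip: scale_of_real)
  show "\<exists>K. \<forall>a b. norm (ip a b) \<le> norm a * norm b * K"
    using norm_ip_le by (intro exI[of _ 1]) simp
qed (simp_all add: ip_add_left ip_add_right)

lemma bounded_bilinear_scale: "bounded_bilinear scale"
proof
  show "scale (r *\<^sub>R c) x = r *\<^sub>R scale c x" for r c x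
    by (simp add: scaleR_conv_of_real flip: scale_of_real)
  show "scale c (r *\<^sub>R x) = r *\<^sub>R scale c x" for r c x
    by (simp add: mult.commute flip: scale_of_real)
  show "\<exists>K. \<forall>a b. norm (scale a b) \<le> norm a * norm b * K"
    by (intro exI[of _ 1]) (simp add: norm_scale)
qed (simp_all add: scale_left_distrib scale_right_distrib)

interpretation ip: bounded_bilinear ip by (rule bounded_bilinear_ip)
interpretation scale: bounded_bilinear scale by (rule bounded_bilinear_scale)

lemma norm_add_orthogonal:
  assumes "ip x y = 0"
  shows "(norm (x + y))\<^sup>2 = (norm x)\<^sup>2 + (norm y)\<^sup>2"
proof -
  have "(of_real ((norm (x + y))\<^sup>2) :: 'k) = of_real ((norm x)\<^sup>2 + (norm y)\<^sup>2)"
    using assms ip_eq_0_commute[of x y]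
    by (simp only: of_real_add ip_add_left ip_add_right flip: ip_self) simp
  thus ?thesis by (simp only: of_real_eq_iff)
qed

lemma perp_antimono: "A \<subseteq> B \<Longrightarrow> perp B \<subseteq> perp A"
  by (auto simp: perp_def)

lemma subset_perp_perp: "A \<subseteq> perp (perp A)"
  using ip_eq_0_commute by (auto simp: perp_def)

lemma perp_zero: "perp {0} = UNIV"
  by (simp add: perp_def ip.zero_right)

lemma subset_perp_iff: "A \<subseteq> perp B \<longleftrightarrow> B \<subseteq> perp A"
  using ip_eq_0_commute by (auto simp: perp_def)

lemma perp_self_zero: "x \<in> A \<Longrightarrow> x \<in> perp A \<Longrightarrow> x = 0"
  by (auto simp: perp_def ip_self_eq_0_iff)

lemma subspace_perp: "subspace (perp A)"
  by (rule subspaceI) (auto simp: perp_def ip.zero_left ip_add_left ip_scale_left)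

lemma perp_span: "perp (span A) = perp A"
proof
  show "perp (span A) \<subseteq> perp A" by (intro perp_antimono span_superset)
  have "span A \<subseteq> perp (perp A)" by (intro span_minimal subset_perp_perp subspace_perp)
  thus "perp A \<subseteq> perp (span A)" by (simp add: subset_perp_iff)
qed

lemma closed_perp: "closed (perp A)"
  unfolding perp_def Collect_ball_eq
  by (intro closed_INT ballI closed_Collect_eq continuous_on_const
      bounded_linear.continuous_on[OF ip.bounded_linear_left] continuous_on_id)

lemma closure_subset_perp_perp: "closure A \<subseteq> perp (perp A)"
  by (intro closure_minimal subset_perp_perp closed_perp)

lemma orth_proj_unique:
  assumes "subspace M" "m \<in> M" "x - m \<in> perp M" "m' \<in> M" "x - m' \<in> perp M"
  shows "m = m'"
proof -
  have "(x - m') - (x - m) \<in> perp M" using assms subspace_diff[OF subspace_perp] by blast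
  moreover have "m - m' \<in> M" using assms subspace_diff by blast
  ultimately show ?thesis using perp_self_zero[of "m - m'" M] by simp
qed

subsection \<open>Finite-dimensional subspaces\<close>

definition orthonormal :: "'s set \<Rightarrow> bool" where
  "orthonormal B \<longleftrightarrow> (\<forall>a\<in>B. \<forall>b\<in>B. ip a b = (if a = b then 1 else 0))"

text \<open>For a finite orthonormal \<open>B\<close> this is the orthogonal projection onto
  \<open>span B\<close>; it exists without completeness.\<close>

definition fin_proj :: "'s set \<Rightarrow> 's \<Rightarrow> 's" where
  "fin_proj B x = (\<Sum>b\<in>B. scale (ip x b) b)"

lemma fin_proj_in_span: "fin_proj B x \<in> span B"
  unfolding fin_proj_def by (intro span_sum span_scale span_base)

lemma fin_proj_perp:
  assumes "finite B" "orthonormal B"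
  shows "x - fin_proj B x \<in> perp (span B)"
  unfolding perp_span
proof (unfold perp_def, intro CollectI ballI)
  fix a assume a: "a \<in> B"
  have "ip (fin_proj B x) a = (\<Sum>b\<in>B. ip x b * ip b a)"
    by (simp add: fin_proj_def ip.sum_left ip_scale_left)
  also have "\<dots> = (\<Sum>b\<in>B. if b = a then ip x b else 0)"
    using a assms(2) by (intro sum.cong) (auto simp: orthonormal_def)
  also have "\<dots> = ip x a" using a assms(1) by simp
  finally show "ip (x - fin_proj B x) a = 0" by (simp add: ip.diff_left)
qed

text \<open>Each new vector is replaced by its component orthogonal to the basis found so far, which
  is dropped if zero and normalised otherwise. This makes \<open>fin_proj\<close> available for the
  span of any finite set.\<close>

lemma gram_schmidt:
  assumes "finite A"
  obtains B where "finite B" "orthonormal B" "span B = span A"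
proof -
  have "\<exists>B. finite B \<and> orthonormal B \<and> span B = span A" using assms
  proof induction
    case empty
    show ?case by (intro exI[of _ "{}"]) (simp add: orthonormal_def)
  next
    case (insert u A)
    then obtain B where B: "finite B" "orthonormal B" "span B = span A" by blast
    define v where "v = u - fin_proj B u"
    have v: "v \<in> perp B" using fin_proj_perp[OF B(1,2)] by (simp add: v_def perp_span)
    have su: "span (insert u A) = span (insert v B)"
    proof -
      have "span (insert u A) = span (insert u B)"
        using B(3) by (metis span_insert)
      also have "\<dots> = span (insert v B)"
      proof (rule span_eq[THEN iffD2], intro conjI insert_subsetI)
        have p: "fin_proj B u \<in> span (insert x B)" for x
          using fin_proj_in_span span_mono[OF subset_insertI] by blast
        show "v \<in> span (insert u B)" unfolding v_def by (intro span_diff p span_base) simp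
        have "v + fin_proj B u \<in> span (insert v B)" by (intro span_add p span_base) simp
        thus "u \<in> span (insert v B)" by (simp add: v_def)
      qed (auto intro: span_base)
      finally show ?thesis .
    qed
    show ?case
    proof (cases "v = 0")
      case True
      thus ?thesis using B su by (intro exI[of _ B]) (simp add: span_insert_0)
    next
      case False
      define w where "w = scale (of_real (1 / norm v)) v"
      have "ip w w = 1" using False
        by (simp add: w_def ip_self norm_scale norm_divide)
      moreover have "ip w b = 0" "ip b w = 0" if "b \<in> B" for b
        using v that ip_eq_0_commute by (auto simp: w_def perp_def ip_scale_left ip_scale_right)
      ultimately have "orthonormal (insert w B)"
        using B(2) by (auto simp: orthonormal_def)
      moreover have "span (insert w B) = span (insert v B)"
      proof (rule span_eq[THEN iffD2], intro conjI insert_subsetI)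
        show "w \<in> span (insert v B)" unfolding w_def by (intro span_scale span_base) simp
        have "v = scale (of_real (norm v)) w" using False by (simp add: w_def flip: of_real_mult)
        thus "v \<in> span (insert w B)" by (metis insertI1 span_base span_scale)
      qed (auto intro: span_base)
      ultimately show ?thesis using B(1) su by (intro exI[of _ "insert w B"]) simp
    qed
  qed
  thus thesis using that by blast
qed

text \<open>For \<open>x\<close> in \<open>perp (perp A)\<close>, the difference from its projection
  onto \<open>span A\<close> lies in both \<open>perp A\<close> and \<open>perp (perp A)\<close>,
  hence vanishes.\<close>

lemma perp_perp_span_finite:
  assumes "finite A"
  shows "perp (perp A) = span A"
proof
  obtain B where B: "finite B" "orthonormal B" "span B = span A" using gram_schmidt[OF assms] .
  show "perp (perp A) \<subseteq> span A"
  proof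
    fix x assume x: "x \<in> perp (perp A)"
    have "x - fin_proj B x \<in> perp A" using fin_proj_perp[OF B(1,2), of x] B(3) by (simp add: perp_span)
    moreover have "fin_proj B x \<in> perp (perp A)"
      using fin_proj_in_span[of B x] B(3) subset_perp_perp[of "span A"] by (auto simp: perp_span)
    hence "x - fin_proj B x \<in> perp (perp A)" using x subspace_diff[OF subspace_perp] by blast
    ultimately have "x - fin_proj B x = 0" by (intro perp_self_zero)
    thus "x \<in> span A" using fin_proj_in_span[of B x] B(3) by simp
  qed
  show "span A \<subseteq> perp (perp A)" using subset_perp_perp[of "span A"] by (simp add: perp_span)
qed

lemma bounded_linear_fin_proj: "bounded_linear (fin_proj B)"
  unfolding fin_proj_def
  by (intro bounded_linear_sum bounded_linear_compose[OF scale.bounded_linear_left]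
      ip.bounded_linear_left)

subsection \<open>Cauchy sequences without limit\<close>

text \<open>This replaces the inner product with a point of the completion: \<open>p\<close> stands
  for that point, the limit of the scalars for the inner product with it.\<close>

lemma ip_Cauchy_convergent:
  assumes "Cauchy p"
  shows "convergent (\<lambda>n. ip x (p n))" "convergent (\<lambda>n. ip (p n) x)"
  by (intro rc_Cauchy_convergent bounded_linear.Cauchy[OF ip.bounded_linear_right assms]
      bounded_linear.Cauchy[OF ip.bounded_linear_left assms])+

text \<open>Take a Cauchy sequence without limit and subtract its projection onto
  \<open>span A\<close>. The projections converge, having finitely many convergent coefficients, so
  the remainder \<open>d\<close> still has no limit; it is scaled down and shifted by
  \<open>e\<close>.\<close>

lemma incomplete_perp_near:
  assumes S: "\<not> complete (UNIV :: 's set)" and A: "finite A" and e: "e \<in> perp A" and \<epsilon>: "0 < \<epsilon>"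
  obtains p where "Cauchy p" "\<not> convergent p" "\<And>n. p n \<in> perp A" "\<And>n. norm (p n - e) < \<epsilon>"
proof -
  obtain c :: "nat \<Rightarrow> 's" where c: "Cauchy c" "\<not> convergent c"
    using S unfolding complete_def convergent_def by auto
  obtain B where B: "finite B" "orthonormal B" "span B = span A" using gram_schmidt[OF A] .
  define d where "d n = c n - fin_proj B (c n)" for n
  have d_perp: "d n \<in> perp A" for n
    using fin_proj_perp[OF B(1,2), of "c n"] B(3) by (simp add: d_def perp_span)
  have conv: "convergent (\<lambda>n. fin_proj B (c n))"
  proof -
    have "convergent (\<lambda>n. scale (ip (c n) b) b)" for b
      using ip_Cauchy_convergent(2)[OF c(1)] bounded_linear.tendsto[OF scale.bounded_linear_left]
      unfolding convergent_def by blast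
    thus ?thesis unfolding fin_proj_def by (intro convergent_sum)
  qed
  have "Cauchy d"
    unfolding d_def
    by (rule bounded_linear.Cauchy[OF _ c(1)])
      (intro bounded_linear_sub bounded_linear_ident bounded_linear_fin_proj)
  have nd: "\<not> convergent d"
  proof
    assume "convergent d"
    hence "convergent (\<lambda>n. d n + fin_proj B (c n))" using conv by (rule convergent_add)
    thus False using c(2) by (simp add: d_def)
  qed
  obtain K where K: "K > 0" "\<And>n. norm (d n) \<le> K"
    using Cauchy_Bseq[OF \<open>Cauchy d\<close>] by (rule BseqE) blast
  \<comment> \<open>\<open>K\<close> bounds \<open>d\<close>, so every shift
    \<open>\<delta> *\<^sub>R d n\<close> has norm at most \<open>\<epsilon> / 2\<close>.\<close>
  define \<delta> where "\<delta> = \<epsilon> / (2 * K)"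
  have \<delta>: "\<delta> > 0" using \<epsilon> K by (simp add: \<delta>_def)
  define p where "p n = e + \<delta> *\<^sub>R d n" for n
  show thesis
  proof (rule that[of p])
    show "Cauchy p" unfolding p_def
      using bounded_linear.Cauchy[OF bounded_linear_scaleR_right \<open>Cauchy d\<close>, of \<delta>]
      by (simp add: Cauchy_def)
    show "\<not> convergent p"
    proof
      assume "convergent p"
      then obtain l where "p \<longlonglongrightarrow> l" by (auto simp: convergent_def)
      hence "(\<lambda>n. (1/\<delta>) *\<^sub>R (p n - e)) \<longlonglongrightarrow> (1/\<delta>) *\<^sub>R (l - e)"
        by (intro tendsto_intros)
      thus False using nd \<delta> by (auto simp: p_def convergent_def)
    qed
    show "p n \<in> perp A" for n
      unfolding p_def scale_of_real[symmetric]
      by (intro subspace_add subspace_scale subspace_perp e d_perp)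
    show "norm (p n - e) < \<epsilon>" for n
    proof -
      have "norm (p n - e) = \<delta> * norm (d n)" using \<delta> by (simp add: p_def)
      also have "\<dots> \<le> \<delta> * K" using K \<delta> by (intro mult_left_mono) auto
      also have "\<dots> < \<epsilon>" using K \<epsilon> by (simp add: \<delta>_def)
      finally show ?thesis .
    qed
  qed
qed

text \<open>
  In the completion, the Cauchy sequence \<open>p\<close> is a vector outside the space, and the set below is its
  orthogonal complement inside \<open>perp A\<close>. By the argument of the Riesz representation theorem, a
  vector of \<open>perp A\<close> orthogonal to that set would be a multiple of the limit of \<open>p\<close>.
\<close>

lemma perp_kernel_nonconvergent:
  assumes A: "finite A" and p: "Cauchy p" "\<not> convergent p" "\<And>n. p n \<in> perp A"
  shows "perp {x \<in> perp A. (\<lambda>n. ip x (p n)) \<longlonglongrightarrow> 0} = span A" (is "perp ?T = _")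
proof
  have "perp (perp A) \<subseteq> perp ?T" by (rule perp_antimono) auto
  thus sub: "span A \<subseteq> perp ?T" by (simp add: perp_perp_span_finite A)
  show "perp ?T \<subseteq> span A"
  proof
    fix x assume x: "x \<in> perp ?T"
    obtain B where B: "finite B" "orthonormal B" "span B = span A" using gram_schmidt[OF A] .
    \<comment> \<open>It suffices that the component \<open>y\<close> of \<open>x\<close> orthogonal
      to \<open>A\<close> is zero.\<close>
    define y where "y = x - fin_proj B x"
    have yA: "y \<in> perp A" using fin_proj_perp[OF B(1,2), of x] B(3) by (simp add: y_def perp_span)
    have yT: "y \<in> perp ?T"
      unfolding y_def using fin_proj_in_span[of B x] B(3) sub x
      by (intro subspace_diff subspace_perp) auto
    define \<phi> where "\<phi> v = lim (\<lambda>n. ip v (p n))" for v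
    have \<phi>: "(\<lambda>n. ip v (p n)) \<longlonglongrightarrow> \<phi> v" for v
      unfolding \<phi>_def using ip_Cauchy_convergent(1)[OF p(1)] by (rule convergent_LIMSEQ_iff[THEN iffD1])
    have "y = 0"
    proof (rule ccontr)
      assume y0: "y \<noteq> 0"
      have \<phi>y: "\<phi> y \<noteq> 0"
      proof
        assume "\<phi> y = 0"
        hence "y \<in> ?T" using \<phi>[of y] yA by simp
        hence "y = 0" using yT by (rule perp_self_zero)
        thus False using y0 by contradiction
      qed
      \<comment> \<open>The scalar makes \<open>ip y z\<close> equal to \<open>\<phi> y\<close>; it
        is conjugated because \<open>ip\<close> is conjugate linear in its second argument.\<close>
      define z where "z = scale (rc_cnj (\<phi> y / ip y y)) y"
      have zA: "z \<in> perp A" unfolding z_def by (intro subspace_scale subspace_perp yA)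
      have ipz: "ip v z = \<phi> v" if v: "v \<in> perp A" for v
      proof -
        \<comment> \<open>This combination is in the kernel of \<open>\<phi>\<close>, so it belongs
          to \<open>?T\<close> and is orthogonal to \<open>y\<close>.\<close>
        let ?v = "v - scale (\<phi> v / \<phi> y) y"
        have "(\<lambda>n. ip v (p n) - (\<phi> v / \<phi> y) * ip y (p n)) \<longlonglongrightarrow> \<phi> v - (\<phi> v / \<phi> y) * \<phi> y"
          by (intro tendsto_intros \<phi>)
        hence "(\<lambda>n. ip ?v (p n)) \<longlonglongrightarrow> 0"
          using \<phi>y by (simp add: ip.diff_left ip_scale_left)
        moreover have "?v \<in> perp A"
          by (intro subspace_diff subspace_scale subspace_perp v yA)
        ultimately have "ip y ?v = 0" using yT by (auto simp: perp_def)
        hence "ip ?v y = 0" using ip_eq_0_commute by blast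
        hence "ip v y = (\<phi> v / \<phi> y) * ip y y" by (simp add: ip.diff_left ip_scale_left)
        thus ?thesis using \<phi>y y0
          by (simp add: z_def ip_scale_right rc_cnj_cnj ip_self_eq_0_iff)
      qed
      \<comment> \<open>For \<open>?v = p n - z\<close>, split \<open>ip ?v ?v\<close> as
        \<open>(ip ?v (p m) - ip ?v z) + ip ?v (p n - p m)\<close>. As \<open>m\<close> grows, the
        bracket tends to 0 because \<open>z\<close> represents \<open>\<phi>\<close>; the rest is at
        most \<open>norm ?v * (r / 2)\<close> by the Cauchy property.\<close>
      have "p \<longlonglongrightarrow> z"
      proof (rule metric_LIMSEQ_I)
        fix r :: real assume r: "0 < r"
        obtain N where N: "\<And>m n. m \<ge> N \<Longrightarrow> n \<ge> N \<Longrightarrow> norm (p m - p n) < r / 2"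
          using CauchyD[OF p(1), of "r/2"] r by auto
        have "dist (p n) z < r" if n: "n \<ge> N" for n
        proof -
          let ?v = "p n - z"
          have "(\<lambda>m. ip ?v (p m) - ip ?v z) \<longlonglongrightarrow> \<phi> ?v - ip ?v z"
            by (intro tendsto_intros \<phi>)
          moreover have "?v \<in> perp A" by (intro subspace_diff subspace_perp p zA)
          ultimately have "(\<lambda>m. norm (ip ?v (p m) - ip ?v z)) \<longlonglongrightarrow> 0"
            using ipz tendsto_norm_zero by fastforce
          hence "(\<lambda>m. norm (ip ?v (p m) - ip ?v z) + norm ?v * (r / 2)) \<longlonglongrightarrow> 0 + norm ?v * (r / 2)"
            by (intro tendsto_intros)
          moreover have "norm (ip ?v ?v) \<le> norm (ip ?v (p m) - ip ?v z) + norm ?v * (r / 2)"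
            if m: "m \<ge> N" for m
          proof -
            have "ip ?v ?v = (ip ?v (p m) - ip ?v z) + ip ?v (p n - p m)"
              by (simp add: ip.diff_right)
            hence "norm (ip ?v ?v) \<le> norm (ip ?v (p m) - ip ?v z) + norm (ip ?v (p n - p m))"
              by (metis norm_triangle_ineq)
            also have "norm (ip ?v (p n - p m)) \<le> norm ?v * (r / 2)"
              by (rule order_trans[OF norm_ip_le mult_left_mono]) (use N[OF n m] in auto)
            finally show ?thesis by simp
          qed
          ultimately have "norm (ip ?v ?v) \<le> 0 + norm ?v * (r / 2)"
            by (intro LIMSEQ_le_const) blast+
          hence "norm ?v * norm ?v \<le> norm ?v * (r / 2)"
            by (simp add: ip_self norm_power power2_eq_square norm_mult)
          thus ?thesis using r by (cases "norm ?v = 0") (auto simp: mult_le_cancel_left dist_norm)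
        qed
        thus "\<exists>N. \<forall>n\<ge>N. dist (p n) z < r" by blast
      qed
      thus False using p(2) by (auto simp: convergent_def)
    qed
    thus "x \<in> span A" using fin_proj_in_span[of B x] B(3) by (simp add: y_def)
  qed
qed

end

section \<open>Suprema in a pre-Hilbert space logic\<close>

context pre_hilbert_logic
begin

interpretation ip: bounded_bilinear ip by (rule bounded_bilinear_ip)
interpretation scale: bounded_bilinear scale by (rule bounded_bilinear_scale)

lemma perp_perp_mem: "M \<in> L \<Longrightarrow> perp (perp M) = M"
  using orth_closed by (simp add: orth_closed_def)

lemma subspace_mem: "M \<in> L \<Longrightarrow> subspace M"
  using orth_closed by (simp add: orth_closed_def)

lemma UNIV_mem: "UNIV \<in> L"
  using perp_mem[OF zero_mem] by (simp add: perp_zero)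

lemma span_finite_mem: "finite A \<Longrightarrow> span A \<in> L"
proof (induction rule: finite_induct)
  case empty
  show ?case by (simp add: zero_mem)
next
  case (insert u A)
  have "span (insert u A) = span (A \<union> {u})" by simp
  also have "\<dots> = {x + y | x y. x \<in> span A \<and> y \<in> span {u}}"
    by (rule span_Un)
  finally show ?case using add_span_mem[OF insert.IH] by simp
qed

lemma perp_finite_mem: "finite A \<Longrightarrow> perp A \<in> L"
  using perp_mem[OF span_finite_mem] by (simp add: perp_span)

text \<open>By De Morgan, the set is the orthogonal complement of the sum of \<open>perp M\<close>
  and \<open>span {u}\<close>: adding a vector to \<open>perp M\<close> cuts \<open>M\<close> by a
  hyperplane.\<close>

lemma mem_perp_finite_inter:
  assumes "M \<in> L"
  shows "M \<inter> perp {u} \<in> L"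
proof -
  let ?N = "{x + y | x y. x \<in> perp M \<and> y \<in> span {u}}"
  have "?N \<in> L" by (rule add_span_mem[OF perp_mem[OF assms]])
  moreover have "perp ?N = perp (perp M) \<inter> perp (span {u})"
  proof
    have "x \<in> ?N" if "x \<in> perp M" for x
      using that span_zero[of "{u}"] by (intro CollectI exI[of _ x] exI[of _ 0]) simp
    moreover have "x \<in> ?N" if "x \<in> span {u}" for x
      using that subspace_0[OF subspace_perp] by (intro CollectI exI[of _ 0] exI[of _ x]) simp
    ultimately show "perp ?N \<subseteq> perp (perp M) \<inter> perp (span {u})"
      by (intro Int_greatest perp_antimono subsetI)
    show "perp (perp M) \<inter> perp (span {u}) \<subseteq> perp ?N"
      by (force simp: perp_def[of ?N] ip_add_right perp_def[of "perp M"] perp_def[of "span {u}"])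
  qed
  ultimately show ?thesis using perp_mem[of ?N] perp_perp_mem[OF assms] by (simp add: perp_span)
qed

text \<open>For \<open>u\<close> in \<open>M\<close> orthogonal to every member of
  \<open>\<A>\<close>, cutting \<open>M\<close> by \<open>perp {u}\<close> leaves an upper bound in
  \<open>L\<close>, so minimality of \<open>M\<close> gives \<open>u \<in> perp {u}\<close>. This
  serves both additivity and suprema of nets.\<close>

lemma isLub_orthogonal_complement:
  assumes "isLub L \<A> M"
  shows "M \<inter> perp (\<Union>\<A>) = {0}"
proof -
  have M: "M \<in> L" and ub: "\<And>A. A \<in> \<A> \<Longrightarrow> A \<subseteq> M"
    and least: "\<And>N. N \<in> L \<Longrightarrow> (\<And>A. A \<in> \<A> \<Longrightarrow> A \<subseteq> N) \<Longrightarrow> M \<subseteq> N"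
    using assms unfolding isLub_def leastP_def isUb_def setle_def setge_def by auto
  have "u = 0" if u: "u \<in> M" "u \<in> perp (\<Union>\<A>)" for u
  proof -
    have "A \<subseteq> perp {u}" if "A \<in> \<A>" for A
      using u(2) that ip_eq_0_commute by (auto simp: perp_def)
    hence "M \<subseteq> M \<inter> perp {u}" using ub by (intro least mem_perp_finite_inter M) auto
    hence "u \<in> perp {u}" using u(1) by blast
    thus "u = 0" by (intro perp_self_zero[of u "{u}"]) simp_all
  qed
  moreover have "0 \<in> M" "0 \<in> perp (\<Union>\<A>)"
    using subspace_0 subspace_mem[OF M] subspace_perp by blast+
  ultimately show ?thesis by auto
qed

section \<open>Incomplete spaces\<close>

text \<open>Each vector of \<open>M\<close> lies in the span of itself and \<open>A\<close>.
  Requiring \<open>A \<subseteq> G\<close> keeps prescribed vectors in every subspace of the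
  net.\<close>

lemma net_up_span_finite:
  assumes A: "finite A" "A \<subseteq> M" and M: "M \<in> L"
  shows "net_up L {G. finite G \<and> A \<subseteq> G \<and> G \<subseteq> M} (\<subseteq>) span M"
proof (rule net_upI)
  fix N assume N: "N \<in> L" "\<And>G. G \<in> {G. finite G \<and> A \<subseteq> G \<and> G \<subseteq> M} \<Longrightarrow> span G \<subseteq> N"
  show "M \<subseteq> N"
  proof
    fix x assume "x \<in> M"
    hence "span (insert x A) \<subseteq> N" using A by (intro N(2)) auto
    thus "x \<in> N" using span_base[of x "insert x A"] by auto
  qed
next
  fix G assume "G \<in> {G. finite G \<and> A \<subseteq> G \<and> G \<subseteq> M}"
  thus "span G \<subseteq> M" using subspace_mem[OF M] by (intro span_minimal) auto
qed (use M in \<open>auto intro: span_finite_mem span_mono[THEN subsetD]\<close>)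

text \<open>Singletons \<open>F\<close> already force a lower bound into \<open>perp T\<close>;
  larger finite sets make the family directed.\<close>

lemma net_down_perp_finite:
  assumes "perp T \<in> L"
  shows "net_down L {F. finite F \<and> F \<subseteq> T} (\<subseteq>) perp (perp T)"
proof (rule net_downI)
  fix N assume N: "N \<in> L" "\<And>F. F \<in> {F. finite F \<and> F \<subseteq> T} \<Longrightarrow> N \<subseteq> perp F"
  have "N \<subseteq> perp {x}" if "x \<in> T" for x using that by (intro N(2)) auto
  thus "N \<subseteq> perp T" by (auto simp: perp_def)
qed (use assms in \<open>auto intro: perp_finite_mem perp_antimono[THEN subsetD]\<close>)

lemma directed_finite_subsets:
  assumes "finite A" "A \<subseteq> M"
  shows "directed_index {G. finite G \<and> A \<subseteq> G \<and> G \<subseteq> M} (\<subseteq>)"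
  unfolding directed_index_def
proof (intro conjI ballI)
  show "{G. finite G \<and> A \<subseteq> G \<and> G \<subseteq> M} \<noteq> {}" using assms by auto
  show "reflp_on {G. finite G \<and> A \<subseteq> G \<and> G \<subseteq> M} (\<subseteq>)" by (auto simp: reflp_on_def)
  show "transp_on {G. finite G \<and> A \<subseteq> G \<and> G \<subseteq> M} (\<subseteq>)" by (auto simp: transp_on_def)
  fix G H assume "G \<in> {G. finite G \<and> A \<subseteq> G \<and> G \<subseteq> M}" "H \<in> {G. finite G \<and> A \<subseteq> G \<and> G \<subseteq> M}"
  thus "\<exists>K\<in>{G. finite G \<and> A \<subseteq> G \<and> G \<subseteq> M}. G \<subseteq> K \<and> H \<subseteq> K"
    by (intro bexI[of _ "G \<union> H"]) auto
qed

text \<open>The inductive step for the chain in \<open>open_zero_meets_open_UNIV\<close>. The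
  subspace passes from \<open>span A\<close> up to \<open>perp F\<close> and then down to a
  finite-dimensional one, staying in \<open>U\<close> both times.\<close>

lemma open_extend_towards:
  assumes S: "\<not> complete (UNIV :: 's set)" and U: "openin (o_topology L) U"
    and A: "finite A" "span A \<in> U" and \<epsilon>: "0 < \<epsilon>"
  shows "\<exists>G. finite G \<and> A \<subseteq> G \<and> span G \<in> U \<and> (\<exists>w\<in>span G. norm (e - w) < \<epsilon>)"
proof -
  obtain B where B: "finite B" "orthonormal B" "span B = span A" using gram_schmidt[OF A(1)] .
  \<comment> \<open>The projection of \<open>e\<close> already lies in \<open>span A\<close>, so
    only the remainder \<open>e'\<close> has to be approximated.\<close>
  define e' where "e' = e - fin_proj B e"
  have e': "e' \<in> perp A" using fin_proj_perp[OF B(1,2), of e] B(3) by (simp add: e'_def perp_span)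
  \<comment> \<open>Half of \<open>\<epsilon>\<close> is spent on the distance from
    \<open>p n\<close> to \<open>e'\<close>, the other half on projecting \<open>p n\<close> into
    \<open>perp F\<close>.\<close>
  obtain p where p: "Cauchy p" "\<not> convergent p" "\<And>n. p n \<in> perp A" "\<And>n. norm (p n - e') < \<epsilon> / 2"
    using incomplete_perp_near[OF S A(1) e', of "\<epsilon> / 2"] \<epsilon> by auto
  define T where "T = {x \<in> perp A. (\<lambda>n. ip x (p n)) \<longlonglongrightarrow> 0}"
  have T: "perp T = span A" unfolding T_def by (rule perp_kernel_nonconvergent[OF A(1) p(1-3)])
  have "\<exists>F\<in>{F. finite F \<and> F \<subseteq> T}. perp F \<in> U"
    using directed_finite_subsets[of "{}" T] net_down_perp_finite[of T] A(2)
    by (intro o_open_meets_net_down[OF U]) (simp_all add: T span_finite_mem A(1))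
  then obtain F where F: "finite F" "F \<subseteq> T" "perp F \<in> U" by blast
  obtain C where C: "finite C" "orthonormal C" "span C = span F" using gram_schmidt[OF F(1)] .
  \<comment> \<open>The limit is 0 on \<open>F\<close> by definition of \<open>T\<close>; linearity
    carries this to the orthonormal basis \<open>C\<close>, so the projections of \<open>p n\<close>
    onto \<open>span F\<close> tend to 0.\<close>
  have "(\<lambda>n. ip (p n) c) \<longlonglongrightarrow> 0" if "c \<in> C" for c
  proof -
    have "subspace {x. (\<lambda>n. ip x (p n)) \<longlonglongrightarrow> 0}"
      by (rule subspaceI) (auto simp: ip.zero_left ip_add_left ip_scale_left intro: tendsto_add_zero tendsto_mult_right_zero)
    hence "span F \<subseteq> {x. (\<lambda>n. ip x (p n)) \<longlonglongrightarrow> 0}"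
      using F(2) by (intro span_minimal) (auto simp: T_def)
    hence "(\<lambda>n. ip c (p n)) \<longlonglongrightarrow> 0" using that C(3) span_base[of c C] by auto
    hence "(\<lambda>n. norm (ip c (p n))) \<longlonglongrightarrow> 0" by (rule tendsto_norm_zero)
    hence "(\<lambda>n. norm (ip (p n) c)) \<longlonglongrightarrow> 0" by (metis (no_types, lifting) ext ip_commute norm_rc_cnj)
    thus ?thesis by (rule tendsto_norm_zero_cancel)
  qed
  hence "(\<lambda>n. fin_proj C (p n)) \<longlonglongrightarrow> (\<Sum>c\<in>C. scale 0 c)"
    unfolding fin_proj_def
    by (intro tendsto_sum bounded_linear.tendsto[OF scale.bounded_linear_left])
  hence "(\<lambda>n. fin_proj C (p n)) \<longlonglongrightarrow> 0" by simp
  hence "\<forall>\<^sub>F n in sequentially. norm (fin_proj C (p n)) < \<epsilon> / 2"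
    using \<epsilon> by (intro order_tendstoD(2)[OF tendsto_norm_zero]) auto
  then obtain n where n: "norm (fin_proj C (p n)) < \<epsilon> / 2"
    by (meson eventually_sequentially order_refl)
  define v where "v = p n - fin_proj C (p n)"
  have vF: "v \<in> perp F" using fin_proj_perp[OF C(1,2), of "p n"] C(3) by (simp add: v_def perp_span)
  have "norm (e' - v) = norm (fin_proj C (p n) - (p n - e'))" by (simp add: v_def algebra_simps)
  also have "\<dots> < \<epsilon>" using norm_triangle_ineq4[of "fin_proj C (p n)" "p n - e'"] n p(4)[of n] by simp
  finally have v: "norm (e' - v) < \<epsilon>" .
  \<comment> \<open>Both \<open>A\<close> and \<open>v\<close> lie in \<open>perp F\<close>, so its
    finite-dimensional subspaces may be required to contain them.\<close>
  have "F \<subseteq> perp A" using F(2) by (auto simp: T_def)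
  hence "A \<subseteq> perp F" by (simp add: subset_perp_iff)
  hence A': "finite (insert v A)" "insert v A \<subseteq> perp F" using A(1) vF by auto
  have "\<exists>G\<in>{G. finite G \<and> insert v A \<subseteq> G \<and> G \<subseteq> perp F}. span G \<in> U"
    by (rule o_open_meets_net_up[OF U F(3) directed_finite_subsets[OF A']
          net_up_span_finite[OF A' perp_finite_mem[OF F(1)]]])
  then obtain G where G: "finite G" "insert v A \<subseteq> G" "span G \<in> U" by blast
  have "fin_proj B e \<in> span G" using fin_proj_in_span[of B e] B(3) span_mono[of A G] G(2) by blast
  hence "fin_proj B e + v \<in> span G" using G(2) by (intro span_add[OF _ span_base]) auto
  moreover have "norm (e - (fin_proj B e + v)) < \<epsilon>" using v by (simp add: e'_def algebra_simps)
  ultimately show ?thesis using G by blast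
qed

lemma open_zero_meets_open_UNIV:
  fixes f :: "nat \<Rightarrow> 's"
  assumes S: "\<not> complete (UNIV :: 's set)" and f: "perp (range f) = {0}"
    and U: "openin (o_topology L) U" "{0} \<in> U" and V: "openin (o_topology L) V" "UNIV \<in> V"
  shows "U \<inter> V \<noteq> {}"
proof -
  \<comment> \<open>\<open>prod_decode\<close> runs through all pairs, so every \<open>f j\<close>
    is approximated at infinitely many stages, with tolerance tending to 0.\<close>
  have "\<exists>A. \<forall>k. (finite (A k) \<and> span (A k) \<in> U) \<and>
      (A k \<subseteq> A (Suc k) \<and> (\<exists>w\<in>span (A (Suc k)). norm (f (fst (prod_decode k)) - w) < inverse (Suc k)))"
  proof (rule dependent_nat_choice)
    show "\<exists>A. finite A \<and> span A \<in> U" using U(2) by (intro exI[of _ "{}"]) simp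
    show "\<exists>G. (finite G \<and> span G \<in> U) \<and>
        (A \<subseteq> G \<and> (\<exists>w\<in>span G. norm (f (fst (prod_decode k)) - w) < inverse (Suc k)))"
      if "finite A \<and> span A \<in> U" for A k
      using open_extend_towards[OF S U(1), of A "inverse (Suc k)" "f (fst (prod_decode k))"] that by auto
  qed
  then obtain A where A0: "\<forall>k. (finite (A k) \<and> span (A k) \<in> U) \<and>
      (A k \<subseteq> A (Suc k) \<and> (\<exists>w\<in>span (A (Suc k)). norm (f (fst (prod_decode k)) - w) < inverse (Suc k)))" ..
  have A1: "finite (A k)" and A2: "span (A k) \<in> U" and A3: "A k \<subseteq> A (Suc k)" for k
    using A0 by blast+
  have close: "\<exists>w\<in>span (A (Suc k)). norm (f (fst (prod_decode k)) - w) < inverse (Suc k)" for k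
    using A0 by blast
  have mono: "span (A i) \<subseteq> span (A j)" if "i \<le> j" for i j
    by (rule span_mono[OF lift_Suc_mono_le[of A, OF A3 that]])
  \<comment> \<open>An upper bound \<open>N\<close> is orthogonally closed and has every
    \<open>f j\<close> in its closure, so \<open>perp N\<close> is orthogonal to
    \<open>range f\<close> and trivial.\<close>
  have "net_up L UNIV (\<le>) (\<lambda>k. span (A k)) UNIV"
  proof (rule net_upI)
    fix N assume N: "N \<in> L" "\<And>k. k \<in> UNIV \<Longrightarrow> span (A k) \<subseteq> N"
    have "f j \<in> closure N" for j
      unfolding closure_approachable
    proof (intro allI impI)
      fix r :: real assume "0 < r"
      then obtain n where n: "inverse (Suc n) < r" using reals_Archimedean by blast
      \<comment> \<open>Stage \<open>k\<close> aims at \<open>f j\<close>, and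
        \<open>k \<ge> n\<close> brings its tolerance below \<open>r\<close>.\<close>
      define k where "k = prod_encode (j, n)"
      obtain w where w: "w \<in> span (A (Suc k))" "norm (f j - w) < inverse (Suc k)"
        using close[of k] by (auto simp: k_def)
      have "n \<le> k" using le_prod_encode_2[of n j] by (simp add: k_def)
      hence "inverse (real (Suc k)) \<le> inverse (real (Suc n))" by (intro le_imp_inverse_le) auto
      hence "norm (f j - w) < r" using w(2) n by linarith
      hence "dist w (f j) < r" by (simp add: dist_norm norm_minus_commute)
      thus "\<exists>y\<in>N. dist y (f j) < r" using w(1) N(2)[of "Suc k"] by auto
    qed
    hence "range f \<subseteq> perp (perp N)" using closure_subset_perp_perp by blast
    hence "perp (perp (perp N)) \<subseteq> perp (range f)" by (rule perp_antimono)
    hence "perp N \<subseteq> {0}" unfolding f using perp_perp_mem[OF perp_mem[OF N(1)]] by simp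
    hence "perp {0} \<subseteq> perp (perp N)" by (rule perp_antimono)
    thus "UNIV \<subseteq> N" using perp_perp_mem[OF N(1)] by (simp add: perp_zero)
  qed (use A1 mono in \<open>auto intro: span_finite_mem UNIV_mem\<close>)
  moreover have "directed_index UNIV ((\<le>) :: nat \<Rightarrow> nat \<Rightarrow> bool)"
    unfolding directed_index_def
    by (auto simp: reflp_on_def transp_on_def) (metis max.cobounded1 max.cobounded2)
  ultimately have "\<exists>k\<in>UNIV. span (A k) \<in> V" by (intro o_open_meets_net_up[OF V])
  thus ?thesis using A2 by blast
qed

section \<open>Complete spaces: the projection theorem and vector states\<close>

text \<open>The subspace need not be closed: a minimising sequence in \<open>W\<close> converges to \<open>q\<close>.\<close>

lemma projection_theorem:
  assumes S: "complete (UNIV :: 's set)" and W: "subspace W"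
  obtains q where "q \<in> closure W" "x - q \<in> perp W"
proof -
  define d where "d = Inf ((\<lambda>w. (norm (x - w))\<^sup>2) ` W)"
  have bdd: "bdd_below ((\<lambda>w. (norm (x - w))\<^sup>2) ` W)" by (rule bdd_belowI[of _ 0]) auto
  have ne: "W \<noteq> {}" using subspace_0[OF W] by auto
  have d: "d \<le> (norm (x - w))\<^sup>2" if "w \<in> W" for w
    unfolding d_def using bdd that by (intro cInf_lower) auto
  define h where "h n = inverse (real (Suc n))" for n
  have h_pos: "0 < h n" for n by (simp add: h_def)
  have "\<exists>w\<in>W. (norm (x - w))\<^sup>2 < d + h n" for n
    using cInf_lessD[of "(\<lambda>w. (norm (x - w))\<^sup>2) ` W" "d + h n"] ne h_pos[of n] by (auto simp: d_def)
  then obtain w where w: "\<And>n. w n \<in> W" "\<And>n. (norm (x - w n))\<^sup>2 < d + h n" by metis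
  have scaleR_W: "r *\<^sub>R v \<in> W" if "v \<in> W" for r v
    using subspace_scale[OF W that, of "of_real r"] by (simp add: scale_of_real)
  \<comment> \<open>Parallelogram identity with the midpoint \<open>c\<close>, whose squared
    distance from \<open>x\<close> is at least \<open>d\<close>.\<close>
  have diff: "(norm (w m - w n))\<^sup>2 < 2 * (h m + h n)" for m n
  proof -
    define c where "c = (1/2) *\<^sub>R (w m + w n)"
    have "c \<in> W" unfolding c_def by (intro scaleR_W subspace_add W w)
    hence "d \<le> (norm (x - c))\<^sup>2" by (rule d)
    moreover have "(norm (w m - w n))\<^sup>2 = 2 * (norm (x - w m))\<^sup>2 + 2 * (norm (x - w n))\<^sup>2 - 4 * (norm (x - c))\<^sup>2"
      by (simp add: c_def power2_norm_eq_inner inner_simps inner_commute algebra_simps)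
    moreover have "(norm (x - w m))\<^sup>2 < d + h m" "(norm (x - w n))\<^sup>2 < d + h n" by (rule w(2))+
    ultimately show ?thesis by argo
  qed
  have "Cauchy w"
  proof (rule CauchyI)
    fix r :: real assume "0 < r"
    then obtain N where N: "h N < r\<^sup>2 / 4"
      using reals_Archimedean[of "r\<^sup>2 / 4"] by (auto simp: h_def)
    have "norm (w m - w n) < r" if mn: "m \<ge> N" "n \<ge> N" for m n
    proof -
      have "h m \<le> h N" "h n \<le> h N"
        using mn unfolding h_def by (auto intro!: le_imp_inverse_le)
      hence "(norm (w m - w n))\<^sup>2 < r\<^sup>2" using diff[of m n] N by argo
      thus ?thesis using \<open>0 < r\<close> by (simp add: power_less_imp_less_base)
    qed
    thus "\<exists>M. \<forall>m\<ge>M. \<forall>n\<ge>M. norm (w m - w n) < r" by blast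
  qed
  then obtain q where q: "w \<longlonglongrightarrow> q" using S by (auto simp: complete_def)
  have "(\<lambda>n. (norm (x - w n))\<^sup>2) \<longlonglongrightarrow> (norm (x - q))\<^sup>2"
    by (intro tendsto_intros q)
  moreover have "(\<lambda>n. d + h n) \<longlonglongrightarrow> d + 0"
    unfolding h_def by (intro tendsto_intros LIMSEQ_inverse_real_of_nat)
  ultimately have qd: "(norm (x - q))\<^sup>2 \<le> d"
    using w(2) by (intro LIMSEQ_le[of _ _ "\<lambda>n. d + h n" d]) (auto intro: less_imp_le)
  \<comment> \<open>\<open>q\<close> need not lie in \<open>W\<close>, but \<open>q + v\<close> is
    the limit of the points \<open>w n + v\<close> of \<open>W\<close>, so its distance from
    \<open>x\<close> obeys the same bound.\<close>
  have min: "(norm (x - q))\<^sup>2 \<le> (norm (x - q - v))\<^sup>2" if v: "v \<in> W" for v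
  proof -
    have "(\<lambda>n. (norm (x - (w n + v)))\<^sup>2) \<longlonglongrightarrow> (norm (x - (q + v)))\<^sup>2"
      by (intro tendsto_intros q)
    moreover have "d \<le> (norm (x - (w n + v)))\<^sup>2" for n
      by (intro d subspace_add W w v)
    ultimately have "d \<le> (norm (x - (q + v)))\<^sup>2" by (intro LIMSEQ_le_const) auto
    with qd have "(norm (x - q))\<^sup>2 \<le> (norm (x - (q + v)))\<^sup>2" by (rule order_trans)
    thus ?thesis by (simp only: diff_diff_eq)
  qed
  have "ip (x - q) v = 0" if v: "v \<in> W" for v
  proof (rule ccontr)
    assume n0: "ip (x - q) v \<noteq> 0"
    hence v0: "v \<noteq> 0" by (auto simp: ip.zero_right)
    \<comment> \<open>\<open>u\<close> is the component of \<open>x - q\<close> along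
      \<open>v\<close>; by Pythagoras, removing it would strictly reduce the norm, against
      \<open>min\<close>.\<close>
    define u where "u = scale (ip (x - q) v / ip v v) v"
    have "ip (x - q - u) v = 0" using v0 by (simp add: u_def ip.diff_left ip_scale_left ip_self_eq_0_iff)
    hence "ip (x - q - u) u = 0" by (simp add: u_def ip_scale_right)
    hence "(norm (x - q - u + u))\<^sup>2 = (norm (x - q - u))\<^sup>2 + (norm u)\<^sup>2" by (rule norm_add_orthogonal)
    moreover have "u \<noteq> 0" using n0 v0 by (simp add: u_def ip_self_eq_0_iff)
    hence "0 < (norm u)\<^sup>2" by simp
    ultimately show False using min[of u] subspace_scale[OF W v] by (simp add: u_def)
  qed
  hence "x - q \<in> perp W" by (auto simp: perp_def)
  moreover have "q \<in> closure W" using q w(1) closure_sequential by blast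
  ultimately show thesis using that by blast
qed

text \<open>Existence is not part of the definition; \<open>orth_proj_mem\<close> supplies it for
  members of \<open>L\<close> in a complete space.\<close>

definition orth_proj :: "'s set \<Rightarrow> 's \<Rightarrow> 's" where
  "orth_proj M x = (THE m. m \<in> M \<and> x - m \<in> perp M)"

lemma orth_proj_eqI: "subspace M \<Longrightarrow> m \<in> M \<Longrightarrow> x - m \<in> perp M \<Longrightarrow> orth_proj M x = m"
  unfolding orth_proj_def by (rule the_equality) (auto intro: orth_proj_unique)

definition vector_state :: "'s \<Rightarrow> 's set \<Rightarrow> real" where
  "vector_state e M = (norm (orth_proj M e))\<^sup>2"

context
  assumes S: "complete (UNIV :: 's set)"
begin

lemma orth_proj_mem:
  assumes M: "M \<in> L"
  shows "orth_proj M x \<in> M" "x - orth_proj M x \<in> perp M"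
proof -
  obtain q where q: "q \<in> closure M" "x - q \<in> perp M"
    using projection_theorem[OF S subspace_mem[OF M]] .
  hence "q \<in> M" using closure_subset_perp_perp perp_perp_mem[OF M] by blast
  moreover from this have "orth_proj M x = q" using q subspace_mem[OF M] by (intro orth_proj_eqI)
  ultimately show "orth_proj M x \<in> M" "x - orth_proj M x \<in> perp M" using q by auto
qed

lemma orth_proj_perp: "M \<in> L \<Longrightarrow> orth_proj (perp M) x = x - orth_proj M x"
  using orth_proj_mem[of M x] subset_perp_perp
  by (intro orth_proj_eqI subspace_perp) auto

lemma ip_orth_proj: "M \<in> L \<Longrightarrow> y \<in> M \<Longrightarrow> ip (orth_proj M x) y = ip x y"
  using orth_proj_mem(2)[of M x] by (auto simp: perp_def ip.diff_left)

text \<open>Pythagoras. It lets infima of values along decreasing nets be read off from the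
  increasing nets of complements.\<close>

lemma vector_state_perp:
  assumes M: "M \<in> L"
  shows "vector_state e M + vector_state e (perp M) = (norm e)\<^sup>2"
proof -
  have "ip (orth_proj M e) (e - orth_proj M e) = 0"
    using orth_proj_mem[OF M, of e] ip_eq_0_commute by (auto simp: perp_def)
  from norm_add_orthogonal[OF this] show ?thesis
    by (simp add: vector_state_def orth_proj_perp[OF M])
qed

lemma vector_state_bounds:
  assumes M: "M \<in> L"
  shows "0 \<le> vector_state e M" "vector_state e M \<le> (norm e)\<^sup>2"
proof -
  have nonneg: "0 \<le> vector_state e N" for N by (simp add: vector_state_def)
  show "0 \<le> vector_state e M" by (rule nonneg)
  show "vector_state e M \<le> (norm e)\<^sup>2"
    using vector_state_perp[OF M, of e] nonneg[of "perp M"] by linarith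
qed

text \<open>This separates points: a unit vector in \<open>M\<close> but not in \<open>N\<close>
  gives 1 at \<open>M\<close> and less than 1 at \<open>N\<close>.\<close>

lemma vector_state_eq_iff:
  assumes M: "M \<in> L"
  shows "vector_state e M = (norm e)\<^sup>2 \<longleftrightarrow> e \<in> M"
proof
  assume "vector_state e M = (norm e)\<^sup>2"
  hence "orth_proj (perp M) e = 0" using vector_state_perp[OF M, of e] by (simp add: vector_state_def)
  thus "e \<in> M" using orth_proj_mem(1)[OF M, of e] by (simp add: orth_proj_perp[OF M])
next
  assume "e \<in> M"
  hence "orth_proj M e = e"
    using subspace_0[OF subspace_perp] by (intro orth_proj_eqI subspace_mem M) simp_all
  thus "vector_state e M = (norm e)\<^sup>2" by (simp add: vector_state_def)
qed

text \<open>Since \<open>m - a\<close> is orthogonal to \<open>A\<close>, the vector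
  \<open>a\<close> is also the projection of \<open>m\<close> onto \<open>A\<close>. So the
  difference is \<open>(norm (m - a))\<^sup>2\<close>, and no \<open>r\<close> in \<open>A\<close>
  is closer to \<open>m\<close> than \<open>a\<close>.\<close>

lemma vector_state_diff_le:
  assumes A: "A \<in> L" and M: "M \<in> L" and AM: "A \<subseteq> M" and r: "r \<in> A"
  shows "0 \<le> vector_state e M - vector_state e A"
    and "vector_state e M - vector_state e A \<le> (norm (orth_proj M e - r))\<^sup>2"
proof -
  define a m where "a = orth_proj A e" and "m = orth_proj M e"
  have am: "ip (m - a) y = 0" if "y \<in> A" for y
    using ip_orth_proj[OF A that, of e] ip_orth_proj[OF M, of y e] AM that
    by (auto simp: a_def m_def ip.diff_left)
  have aA: "a \<in> A" unfolding a_def by (rule orth_proj_mem(1)[OF A])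
  have "(norm (m - a + a))\<^sup>2 = (norm (m - a))\<^sup>2 + (norm a)\<^sup>2"
    by (intro norm_add_orthogonal am aA)
  hence eq: "vector_state e M - vector_state e A = (norm (m - a))\<^sup>2"
    by (simp add: vector_state_def a_def m_def)
  thus "0 \<le> vector_state e M - vector_state e A" by simp
  have "(norm (m - a + (a - r)))\<^sup>2 = (norm (m - a))\<^sup>2 + (norm (a - r))\<^sup>2"
    using subspace_diff[OF subspace_mem[OF A] aA r] by (intro norm_add_orthogonal am)
  thus "vector_state e M - vector_state e A \<le> (norm (orth_proj M e - r))\<^sup>2"
    by (simp add: eq m_def)
qed

text \<open>The vector \<open>c - (a + b)\<close> lies in \<open>C\<close> and is orthogonal to
  \<open>A\<close> and \<open>B\<close>, so \<open>isLub_orthogonal_complement\<close> makes it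
  zero; Pythagoras finishes.\<close>

lemma vector_state_additive:
  assumes A: "A \<in> L" and B: "B \<in> L" and C: "C \<in> L" and AB: "A \<subseteq> perp B" and lub: "isLub L {A, B} C"
  shows "vector_state e C = vector_state e A + vector_state e B"
proof -
  define a b c where "a = orth_proj A e" and "b = orth_proj B e" and "c = orth_proj C e"
  have aA: "a \<in> A" and bB: "b \<in> B" and cC: "c \<in> C"
    using orth_proj_mem(1) A B C by (auto simp: a_def b_def c_def)
  have AC: "A \<subseteq> C" "B \<subseteq> C" using isLubD2[OF lub] by auto
  have ort: "ip y z = 0" "ip z y = 0" if "y \<in> A" "z \<in> B" for y z
    using AB that ip_eq_0_commute by (auto simp: perp_def)
  have "c - (a + b) \<in> C"
    using aA bB cC AC by (intro subspace_diff subspace_add subspace_mem[OF C]) auto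
  moreover have "ip (c - (a + b)) y = 0" if "y \<in> A" for y
    using that AC ort(2)[OF that bB] ip_orth_proj[OF A that, of e] ip_orth_proj[OF C, of y e]
    by (auto simp: a_def[symmetric] c_def[symmetric] ip.diff_left ip_add_left)
  moreover have "ip (c - (a + b)) y = 0" if "y \<in> B" for y
    using that AC ort(1)[OF aA that] ip_orth_proj[OF B that, of e] ip_orth_proj[OF C, of y e]
    by (auto simp: b_def[symmetric] c_def[symmetric] ip.diff_left ip_add_left)
  ultimately have "c - (a + b) \<in> C \<inter> perp (\<Union>{A, B})" by (auto simp: perp_def)
  hence "c - (a + b) = 0" by (simp only: isLub_orthogonal_complement[OF lub] singleton_iff)
  hence "c = a + b" by simp
  moreover have "(norm (a + b))\<^sup>2 = (norm a)\<^sup>2 + (norm b)\<^sup>2"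
    by (intro norm_add_orthogonal ort aA bB)
  ultimately show ?thesis by (simp add: vector_state_def a_def b_def c_def)
qed

text \<open>By \<open>isLub_orthogonal_complement\<close>, the projection of \<open>e\<close> onto
  \<open>M\<close> lies in the closure of the union \<open>W\<close>, hence near some vector of some
  \<open>a i\<close>; \<open>vector_state_diff_le\<close> turns this into closeness of
  values.\<close>

lemma vector_state_net_up:
  assumes I: "directed_index I le" and a: "net_up L I le a M" and \<epsilon>: "0 < \<epsilon>"
  shows "\<exists>i\<in>I. vector_state e M - \<epsilon> < vector_state e (a i)"
proof -
  note aL = net_upD(2)[OF a] and M = net_upD(1)[OF a]
  define W where "W = \<Union>(a ` I)"
  have W: "subspace W"
  proof (rule subspaceI)
    show "0 \<in> W" using I subspace_0[OF subspace_mem[OF aL]] by (auto simp: W_def directed_index_def)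
    show "x + y \<in> W" if xy: "x \<in> W" "y \<in> W" for x y
    proof -
      obtain i j where ij: "i \<in> I" "x \<in> a i" "j \<in> I" "y \<in> a j" using xy by (auto simp: W_def)
      then obtain k where k: "k \<in> I" "le i k" "le j k" using I by (meson directed_index_def)
      hence "x \<in> a k" "y \<in> a k" using ij net_upD(4)[OF a] by blast+
      thus ?thesis using k(1) subspace_add[OF subspace_mem[OF aL]] by (auto simp: W_def)
    qed
    show "scale c x \<in> W" if "x \<in> W" for c x
      using that subspace_scale[OF subspace_mem[OF aL]] by (auto simp: W_def)
  qed
  obtain q where q: "q \<in> closure W" "e - q \<in> perp W" using projection_theorem[OF S W] .
  have WM: "W \<subseteq> M" using net_upD(3)[OF a] by (auto simp: W_def)
  have "closure W \<subseteq> perp (perp M)"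
    using closure_mono[OF WM] closure_subset_perp_perp by blast
  hence qM: "q \<in> M" using q(1) perp_perp_mem[OF M] by auto
  have "orth_proj M e - q \<in> M"
    by (intro subspace_diff subspace_mem M qM orth_proj_mem(1)[OF M])
  moreover have "ip (orth_proj M e - q) y = 0" if "y \<in> W" for y
    using that q(2) ip_orth_proj[OF M, of y e] WM by (auto simp: perp_def ip.diff_left)
  hence "orth_proj M e - q \<in> perp W" by (auto simp: perp_def)
  moreover have "isLub L (a ` I) M" using a by (simp add: net_up_def)
  hence "M \<inter> perp W = {0}" unfolding W_def by (rule isLub_orthogonal_complement)
  ultimately have "orth_proj M e - q = 0" by blast
  hence "orth_proj M e \<in> closure W" using q(1) by simp
  \<comment> \<open>The radius is a square root because \<open>vector_state_diff_le\<close> bounds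
    by the squared distance.\<close>
  then obtain r where r: "r \<in> W" "dist r (orth_proj M e) < sqrt \<epsilon>"
    using \<epsilon> by (meson closure_approachable real_sqrt_gt_zero)
  then obtain i where i: "i \<in> I" "r \<in> a i" by (auto simp: W_def)
  have "(norm (orth_proj M e - r))\<^sup>2 < (sqrt \<epsilon>)\<^sup>2"
    using r(2) by (intro power_strict_mono) (auto simp: dist_norm norm_minus_commute)
  hence "(norm (orth_proj M e - r))\<^sup>2 < \<epsilon>" using \<epsilon> by simp
  thus ?thesis
    using vector_state_diff_le(2)[OF aL[OF i(1)] M net_upD(3)[OF a i(1)] i(2), of e] i(1) by force
qed

text \<open>\<open>perp\<close> is an order-reversing involution on \<open>L\<close>, so it
  exchanges infima and suprema.\<close>

lemma net_down_perp:
  assumes b: "net_down L I le b M"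
  shows "net_up L I le (\<lambda>i. perp (b i)) (perp M)"
proof (rule net_upI)
  fix N assume N: "N \<in> L" "\<And>i. i \<in> I \<Longrightarrow> perp (b i) \<subseteq> N"
  have "perp N \<subseteq> b i" if "i \<in> I" for i
    using perp_antimono[OF N(2)[OF that]] perp_perp_mem net_downD(2)[OF b that] by simp
  hence "perp N \<subseteq> M" using net_downD(5)[OF b perp_mem[OF N(1)]] by blast
  thus "perp M \<subseteq> N" using perp_antimono perp_perp_mem[OF N(1)] by blast
next
  show "perp (b i) \<subseteq> perp (b j)" if "i \<in> I" "j \<in> I" "le i j" for i j
    by (rule perp_antimono[OF net_downD(4)[OF b that]])
  show "perp (b i) \<subseteq> perp M" if "i \<in> I" for i
    by (rule perp_antimono[OF net_downD(3)[OF b that]])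
qed (use net_downD(1,2)[OF b] in \<open>auto intro: perp_mem\<close>)

lemma o_continuous_vector_state:
  assumes e: "norm e = 1"
  shows "o_continuous L {0..1} (vector_state e)"
  unfolding o_continuous_def
proof (intro conjI allI impI)
  have in01: "vector_state e M \<in> {0..1}" if "M \<in> L" for M
    using vector_state_bounds[OF that, of e] e by simp
  thus "vector_state e ` L \<subseteq> {0..1}" by blast
  fix I :: "('s set \<times> 's set \<times> 's set) set" and le x M
  assume "o_converges L I le x M"
  then obtain a b where I: "directed_index I le" and xL: "x ` I \<subseteq> L"
    and a: "net_up L I le a M" and b: "net_down L I le b M"
    and ab: "\<And>i. i \<in> I \<Longrightarrow> a i \<subseteq> x i \<and> x i \<subseteq> b i"
    unfolding o_converges_def by blast
  have mono: "vector_state e A \<le> vector_state e B" if "A \<in> L" "B \<in> L" "A \<subseteq> B" for A B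
    using vector_state_diff_le(1)[OF that, of 0] subspace_0[OF subspace_mem[OF that(1)]] by simp
  note aD = net_upD[OF a] and bD = net_downD[OF b]
  have "net_up {0..1} I le (\<lambda>i. vector_state e (a i)) (vector_state e M)"
  proof (rule net_upI)
    fix y assume y: "y \<in> {0..1}" "\<And>i. i \<in> I \<Longrightarrow> vector_state e (a i) \<le> y"
    show "vector_state e M \<le> y"
    proof (rule field_le_epsilon)
      fix \<epsilon> :: real assume "0 < \<epsilon>"
      then obtain i where "i \<in> I" "vector_state e M - \<epsilon> < vector_state e (a i)"
        using vector_state_net_up[OF I a] by blast
      thus "vector_state e M \<le> y + \<epsilon>" using y(2)[of i] by linarith
    qed
  qed (use aD(1,2,3,4) in \<open>blast intro: mono in01\<close>)+
  moreover have "net_down {0..1} I le (\<lambda>i. vector_state e (b i)) (vector_state e M)"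
  proof (rule net_downI)
    fix y assume y: "y \<in> {0..1}" "\<And>i. i \<in> I \<Longrightarrow> y \<le> vector_state e (b i)"
    show "y \<le> vector_state e M"
    proof (rule field_le_epsilon)
      fix \<epsilon> :: real assume "0 < \<epsilon>"
      then obtain i where i: "i \<in> I" "vector_state e (perp M) - \<epsilon> < vector_state e (perp (b i))"
        using vector_state_net_up[OF I net_down_perp[OF b]] by blast
      thus "y \<le> vector_state e M + \<epsilon>"
        using y(2)[OF i(1)] vector_state_perp[OF bD(1), of e] vector_state_perp[OF bD(2)[OF i(1)], of e]
        by linarith
    qed
  qed (use bD(1,2,3,4) in \<open>blast intro: mono in01\<close>)+
  moreover have "vector_state e (a i) \<le> (vector_state e \<circ> x) i \<and> (vector_state e \<circ> x) i \<le> vector_state e (b i)"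
    if "i \<in> I" for i
    using ab[OF that] aD(2)[OF that] bD(2)[OF that] xL that by (auto intro!: mono)
  moreover have "(vector_state e \<circ> x) ` I \<subseteq> {0..1}" using xL in01 by (auto simp del: atLeastAtMost_iff)
  ultimately show "o_converges {0..1} I le (vector_state e \<circ> x) (vector_state e M)"
    unfolding o_converges_def using I by blast
qed

lemma vector_state_o_continuous_state:
  assumes "norm e = 1"
  shows "vector_state e \<in> o_continuous_states"
  unfolding o_continuous_states_def state_def
  using o_continuous_vector_state[OF assms] vector_state_eq_iff[OF UNIV_mem, of e] assms vector_state_additive
  by (auto simp: o_continuous_def)

lemma Hausdorff_space_o_topology_complete: "Hausdorff_space (o_topology L)"
  unfolding Hausdorff_space_def topspace_o_topology
proof (intro allI impI, elim conjE)
  have sep: "\<exists>U V. openin (o_topology L) U \<and> openin (o_topology L) V \<and> M \<in> U \<and> N \<in> V \<and> disjnt U V"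
    if M: "M \<in> L" and N: "N \<in> L" and x: "x \<in> M" "x \<notin> N" for M N x
  proof -
    \<comment> \<open>Normalised, because o-continuity is established for unit vectors.\<close>
    define e where "e = scale (of_real (inverse (norm x))) x"
    have x0: "x \<noteq> 0" using x(2) subspace_0[OF subspace_mem[OF N]] by auto
    hence e: "norm e = 1" by (simp add: e_def norm_scale norm_inverse)
    have "e \<in> M" unfolding e_def by (intro subspace_scale subspace_mem M x)
    have "x = scale (of_real (norm x)) e" using x0 by (simp add: e_def flip: of_real_mult)
    hence "e \<notin> N" using x(2) subspace_scale[OF subspace_mem[OF N], of e "of_real (norm x)"] by auto
    hence "vector_state e N < 1"
      using vector_state_eq_iff[OF N, of e] vector_state_bounds[OF N, of e] e by (simp add: less_le)
    then obtain c where c: "vector_state e N < c" "c < 1" using dense by blast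
    have "vector_state e M = 1" using vector_state_eq_iff[OF M, of e] \<open>e \<in> M\<close> e by simp
    thus ?thesis
      using c M N openin_o_topology_superlevel[OF o_continuous_vector_state[OF e], of c]
        openin_o_topology_sublevel[OF o_continuous_vector_state[OF e], of c]
      by (intro exI[of _ "{A \<in> L. c < vector_state e A}"] exI[of _ "{A \<in> L. vector_state e A < c}"])
        (auto simp: disjnt_iff)
  qed
  fix M N assume MN: "M \<in> L" "N \<in> L" "M \<noteq> N"
  then consider x where "x \<in> M" "x \<notin> N" | x where "x \<in> N" "x \<notin> M" by blast
  thus "\<exists>U V. openin (o_topology L) U \<and> openin (o_topology L) V \<and> M \<in> U \<and> N \<in> V \<and> disjnt U V"
  proof cases
    case 1
    thus ?thesis using sep MN by blast
  next
    case 2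
    then obtain U V where "openin (o_topology L) U" "openin (o_topology L) V" "N \<in> U" "M \<in> V" "disjnt U V"
      using sep[OF MN(2,1)] by blast
    thus ?thesis by (intro exI[of _ V] exI[of _ U]) (simp add: disjnt_sym)
  qed
qed

end

section \<open>Consequences of incompleteness for states and separation\<close>

lemma o_continuous_states_incomplete:
  fixes f :: "nat \<Rightarrow> 's"
  assumes "\<not> complete (UNIV :: 's set)" "perp (range f) = {0}"
  shows "o_continuous_states = {}"
proof (rule ccontr)
  assume "o_continuous_states \<noteq> {}"
  then obtain s where s: "state s" "o_continuous L {0..1} s" by (auto simp: o_continuous_states_def)
  \<comment> \<open>Additivity for \<open>{0}\<close>, which is orthogonal to itself, gives
    \<open>s {0} = 0\<close>; the level \<open>1 / 2\<close> then separates \<open>{0}\<close> from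
    \<open>UNIV\<close>.\<close>
  have "{0} \<subseteq> perp {0}" by (simp add: perp_zero)
  moreover have "isLub L {{0}, {0}} {0}"
    using zero_mem by (auto simp: isLub_def leastP_def isUb_def setle_def setge_def)
  ultimately have "s {0} = s {0} + s {0}" using s(1) zero_mem unfolding state_def by blast
  hence s0: "s {0} = 0" by simp
  have s1: "s UNIV = 1" using s(1) by (simp add: state_def)
  have "{A \<in> L. s A < 1 / 2} \<inter> {A \<in> L. 1 / 2 < s A} \<noteq> {}"
    by (rule open_zero_meets_open_UNIV[OF assms openin_o_topology_sublevel[OF s(2)] _
          openin_o_topology_superlevel[OF s(2)]]) (simp_all add: s0 s1 zero_mem UNIV_mem)
  thus False by auto
qed

lemma not_Hausdorff_space_incomplete:
  fixes f :: "nat \<Rightarrow> 's"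
  assumes "\<not> complete (UNIV :: 's set)" "perp (range f) = {0}"
  shows "\<not> Hausdorff_space (o_topology L)"
proof
  assume "Hausdorff_space (o_topology L)"
  \<comment> \<open>A one-point space is compact, hence complete.\<close>
  moreover have "{0} \<noteq> (UNIV :: 's set)"
    using assms(1) by (metis compact_imp_complete finite.emptyI finite.insertI finite_imp_compact)
  ultimately obtain U V where "openin (o_topology L) U" "openin (o_topology L) V" "{0} \<in> U" "UNIV \<in> V" "disjnt U V"
    using zero_mem UNIV_mem unfolding Hausdorff_space_def topspace_o_topology by metis
  thus False using open_zero_meets_open_UNIV[OF assms] by (auto simp: disjnt_def)
qed

end

theorem theorem16:
  fixes scale :: "'k::rc_field \<Rightarrow> 's::real_inner \<Rightarrow> 's"
    and ip :: "'s \<Rightarrow> 's \<Rightarrow> 'k"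
    and L :: "'s set set"
  assumes "pre_hilbert_logic scale ip L"
    and "pre_hilbert.has_orth_dim ip natLeq"
  shows "(Hausdorff_space (o_topology L) \<longleftrightarrow> complete (UNIV :: 's set)) \<and>
         (complete (UNIV :: 's set) \<longleftrightarrow> pre_hilbert_logic.o_continuous_states ip L \<noteq> {})"
proof -
  interpret pre_hilbert_logic scale ip L by (rule assms(1))
  \<comment> \<open>The dimension hypothesis supplies a sequence with trivial orthogonal complement
    for the incomplete case, and a unit vector for a vector state in the complete case.\<close>
  obtain A where A: "maximal_orthonormal A" "(card_of A, natLeq) \<in> ordIso"
    using assms(2) by (auto simp: has_orth_dim_def)
  have "(card_of (UNIV :: nat set), card_of A) \<in> ordIso"
    using A(2) card_of_nat ordIso_symmetric ordIso_transitive by blast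
  then obtain f :: "nat \<Rightarrow> 's" where f: "bij_betw f UNIV A"
    using card_of_ordIso by blast
  have range: "range f = A" using f by (simp add: bij_betw_def)
  hence perp: "perp (range f) = {0}" using A(1) by (simp add: maximal_orthonormal_def)
  have "ip (f 0) (f 0) = 1" using A(1) range by (auto simp: maximal_orthonormal_def)
  hence "of_real ((norm (f 0))\<^sup>2) = (of_real 1 :: 'k)" by (simp only: ip_self of_real_1)
  hence "norm (f 0) = 1" by (simp only: of_real_eq_iff power2_eq_1_iff) (use norm_ge_zero[of "f 0"] in linarith)
  hence "complete (UNIV :: 's set) \<Longrightarrow> o_continuous_states \<noteq> {}"
    using vector_state_o_continuous_state by blast
  thus ?thesis
    using Hausdorff_space_o_topology_complete o_continuous_states_incomplete[OF _ perp]
      not_Hausdorff_space_incomplete[OF _ perp] by blast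
qed

end
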